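(* For a reduced tree $T$ of order at least three, the following statements are equivalent: (1) $T$ is well-ve-dominated; (2) $T\in\mathcal{T}$; (3) $\iota(T)=|V(T)|/3$.
   Context: All graphs are finite, simple and undirected. A vertex $v$ ve-dominates an edge $e$ if at least one endpoint of $e$ belongs to the closed neighborhood $N_G[v]$. A set $D\subseteq V(G)$ is a ve-dominating set if every edge of $G$ is ve-dominated by some vertex of $D$; it is minimal if no proper subset is ve-dominating. $G$ is well-ve-dominated if all its minimal ve-dominating sets have the same cardinality. A set $D\subseteq V(G)$ is an isolating set if $G-N_G[D]$ has no edges, where $N_G[D]=\bigcup_{v\in D}N_G[v]$; $\iota(G)$ is the minimum cardinality of an isolating set of $G$. Two distinct vertices $x,y$ are false twins if $N_G(x)=N_G(y)$ (equal open neighborhoods); a graph is reduced if it has no false twins. $\mathcal{T}$ is the family of trees obtained (up to isomorphism) from an arbitrary tree $T_0$ by attaching a pendant path of length two to each vertex of $T_0$: for every $v\in V(T_0)$, add two new vertices $s_v,\ell_v$ and the edges $vs_v$ and $s_v\ell_v$. *)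

theory Defs
  imports Complex_Main "Graph_Theory.Digraph_Isomorphism"
begin

text \<open>
  A finite simple undirected graph is a \<^locale>\<open>pair_graph\<close>: every undirected edge is
  represented by its two opposite arcs. The coercion \<^const>\<open>with_proj\<close> is inserted silently
  where a notion is only defined for general digraphs.
\<close>

definition nbhd :: "'a pair_pre_digraph \<Rightarrow> 'a \<Rightarrow> 'a set" where
  "nbhd G v = {u. (v, u) \<in> parcs G}"

definition closed_nbhd :: "'a pair_pre_digraph \<Rightarrow> 'a \<Rightarrow> 'a set" where
  "closed_nbhd G v = insert v (nbhd G v)"

definition ve_dominates :: "'a pair_pre_digraph \<Rightarrow> 'a \<Rightarrow> 'a \<times> 'a \<Rightarrow> bool" where
  "ve_dominates G v e \<longleftrightarrow> fst e \<in> closed_nbhd G v \<or> snd e \<in> closed_nbhd G v"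

definition ve_dominating :: "'a pair_pre_digraph \<Rightarrow> 'a set \<Rightarrow> bool" where
  "ve_dominating G D \<longleftrightarrow> D \<subseteq> pverts G \<and> (\<forall>e\<in>parcs G. \<exists>v\<in>D. ve_dominates G v e)"

definition minimal_ve_dominating :: "'a pair_pre_digraph \<Rightarrow> 'a set \<Rightarrow> bool" where
  "minimal_ve_dominating G D \<longleftrightarrow>
     ve_dominating G D \<and> (\<forall>D'. D' \<subset> D \<longrightarrow> \<not> ve_dominating G D')"

definition well_ve_dominated :: "'a pair_pre_digraph \<Rightarrow> bool" where
  "well_ve_dominated G \<longleftrightarrow>
     (\<forall>D D'. minimal_ve_dominating G D \<longrightarrow> minimal_ve_dominating G D' \<longrightarrow> card D = card D')"

definition isolating :: "'a pair_pre_digraph \<Rightarrow> 'a set \<Rightarrow> bool" where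
  "isolating G D \<longleftrightarrow>
     D \<subseteq> pverts G \<and> arcs (G \<restriction> (pverts G - (\<Union>v\<in>D. closed_nbhd G v))) = {}"

definition isolation_number :: "'a pair_pre_digraph \<Rightarrow> nat" where
  "isolation_number G = Min (card ` {D. isolating G D})"

definition false_twins :: "'a pair_pre_digraph \<Rightarrow> 'a \<Rightarrow> 'a \<Rightarrow> bool" where
  "false_twins G x y \<longleftrightarrow>
     x \<in> pverts G \<and> y \<in> pverts G \<and> x \<noteq> y \<and> nbhd G x = nbhd G y"

definition reduced :: "'a pair_pre_digraph \<Rightarrow> bool" where
  "reduced G \<longleftrightarrow> \<not> (\<exists>x y. false_twins G x y)"

text \<open>
  The constants \<^const>\<open>forest\<close> and \<^const>\<open>tree\<close> are unsuitable for undirected graphs: there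
  the two opposite arcs of an edge already form a \<^const>\<open>pre_digraph.cycle\<close> of length two.
  The cycles of an undirected graph are the ones of length at least three.
  Note that \<^const>\<open>connected\<close> excludes the graph without vertices.
\<close>

definition undirected_tree :: "'a pair_pre_digraph \<Rightarrow> bool" where
  "undirected_tree G \<longleftrightarrow>
     pair_graph G \<and> connected G \<and> \<not> (\<exists>p. pre_digraph.cycle G p \<and> 3 \<le> length p)"

datatype 'a path_vertex = Base 'a | Support 'a | Leaf 'a

definition attach_paths :: "'a pair_pre_digraph \<Rightarrow> 'a path_vertex pair_pre_digraph" where
  "attach_paths G =
     \<lparr> pverts = Base ` pverts G \<union> Support ` pverts G \<union> Leaf ` pverts G,
       parcs = {(Base u, Base v) | u v. (u, v) \<in> parcs G}
             \<union> {(Base v, Support v) | v. v \<in> pverts G}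
             \<union> {(Support v, Base v) | v. v \<in> pverts G}
             \<union> {(Support v, Leaf v) | v. v \<in> pverts G}
             \<union> {(Leaf v, Support v) | v. v \<in> pverts G} \<rparr>"

text \<open>
  The family of trees is closed under isomorphism. Taking \<open>T0\<close> over the vertex type of \<open>T\<close>
  loses nothing: an isomorphism to a graph \<open>attach_paths T0\<close> embeds \<open>T0\<close> into \<open>T\<close>.
\<close>

definition in_family_T :: "'a pair_pre_digraph \<Rightarrow> bool" where
  "in_family_T T \<longleftrightarrow>
     (\<exists>T0 :: 'a pair_pre_digraph. undirected_tree T0 \<and> digraph_iso (attach_paths T0) T)"

end

theory Submission
  imports Defs
begin

text \<open>
  Say that a vertex reaches the edges that it ve-dominates. A set is isolating if and only if it
  is ve-dominating, so both conditions on the tree are about sets that reach all edges. A tree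
  belongs to the family exactly if its vertex set is partitioned into pendant paths: a leaf, its
  support of degree two, and a base.

  For such a partition both conditions hold. The edge at a leaf is
  reached only from its own pendant path, so every ve-dominating set meets every path. On one path
  the reaches of leaf, support and base increase, so a minimal set meets every path only once
  (\<open>card_covers_ge\<close>, \<open>card_minimal\<close>), and the set of all bases attains the bound |V| / 3.

  For the converse, each condition is used through one counting tool. If all minimal
  ve-dominating sets have the same size, then an irredundant ve-dominating set, in which every
  vertex has a private edge, is never larger than another ve-dominating set; \<open>exchange\<close> is a
  local version of this. If the isolation number is |V| / 3, the tool is a partition of the
  vertices according to their distance from a root modulo three. Every edge away from the root is
  reached from three consecutive levels, so the three classes are essentially isolating, and they
  have |V| elements together. Hence nothing may be saved in any of them (\<open>three_classes\<close>).

  Each tool excludes in turn a support with two inner neighbours, two pendant paths at the same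
  base, two adjacent supports, and finally vertices outside the pendant paths. In the last step
  connectedness provides an outside vertex t next to a base. For the isolation number, t is chosen
  as the root; the bases make t dispensable in its class (\<open>bound_no_rest\<close>). For minimal
  ve-dominating sets, the supports are compared with the bases: the supports leave more edges to
  the outside vertices, which costs an additional vertex with a private edge
  (\<open>well_rest_edge\<close>, \<open>well_no_rest\<close>).

  All facts about trees that are needed (levels with unique parents, branches at a vertex, a leaf
  different from a given vertex, absence of triangles) follow by induction along the growth of a
  tree from a root by adding pendant vertices (\<open>tree_grow\<close>).
\<close>

section \<open>Growing a tree from a root\<close>

locale ve_tree =
  fixes T :: "'a pair_pre_digraph"
  assumes tree: "undirected_tree T"
begin

abbreviation V :: "'a set" where "V \<equiv> pverts T"
abbreviation N :: "'a \<Rightarrow> 'a set" where "N \<equiv> nbhd T"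

lemma pair_graph_T: "pair_graph T"
  using tree by (simp add: undirected_tree_def)

lemma finite_V: "finite V"
proof -
  interpret pair_graph T by (rule pair_graph_T)
  show ?thesis by (rule pair_finite_verts)
qed

lemma arc_iff: "(x, y) \<in> parcs T \<longleftrightarrow> y \<in> N x"
  by (simp add: nbhd_def)

lemma nbhd_sym: "y \<in> N x \<longleftrightarrow> x \<in> N y"
proof -
  interpret pair_graph T by (rule pair_graph_T)
  show ?thesis by (auto simp: nbhd_def intro: arcs_symmetric)
qed

lemma nbhd_irrefl: "x \<notin> N x"
proof -
  interpret pair_graph T by (rule pair_graph_T)
  show ?thesis using no_loops' by (auto simp: nbhd_def)
qed

lemma nbhd_in_V: "y \<in> N x \<Longrightarrow> x \<in> V \<and> y \<in> V"
proof -
  interpret pair_graph T by (rule pair_graph_T)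
  show "y \<in> N x \<Longrightarrow> x \<in> V \<and> y \<in> V" by (auto simp: nbhd_def dest: wellformed')
qed

lemma reachable_in_tree:
  assumes "x \<in> V" "y \<in> V"
  shows "(x, y) \<in> (parcs T)\<^sup>*"
proof -
  interpret pair_graph T by (rule pair_graph_T)
  have "connected T" using tree by (simp add: undirected_tree_def)
  then have "x \<rightarrow>\<^sup>*\<^bsub>mk_symmetric T\<^esub> y"
    using assms by (auto simp: connected_def strongly_connected_def mk_symmetric_def)
  then have "(x, y) \<in> (parcs (mk_symmetric T))\<^sup>*"
    using reachable_rtranclI[of "mk_symmetric T" x y] by simp
  moreover have "parcs (mk_symmetric T) \<subseteq> parcs T"
    by (auto simp: mk_symmetric_def intro: arcs_symmetric)
  ultimately show ?thesis using rtrancl_mono by blast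
qed

lemma edge_leaving:
  assumes "U \<subseteq> V" "t \<in> U" "U \<noteq> V"
  obtains w u where "w \<in> U" "u \<in> V - U" "u \<in> N w"
proof -
  obtain x where x: "x \<in> V - U" using assms by auto
  have "(t, x) \<in> (parcs T)\<^sup>*" using reachable_in_tree assms x by auto
  then have "x \<in> U \<or> (\<exists>w u. w \<in> U \<and> u \<in> V - U \<and> u \<in> N w)"
  proof (induction rule: rtrancl_induct)
    case base then show ?case using assms by simp
  next
    case (step y z) then show ?case using arc_iff nbhd_in_V by blast
  qed
  then show ?thesis using x that by auto
qed

lemma pawalk_verts_snoc:
  "pcas w p w' \<Longrightarrow> pawalk_verts w (p @ [(w', u)]) = pawalk_verts w p @ [u]"
  by (induction p arbitrary: w) auto

lemma pawalk_snoc: "pcas w p w' \<Longrightarrow> pcas w (p @ [(w', u)]) u"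
  by (induction p arbitrary: w) auto

text \<open>
  A vertex with two neighbours in a path-connected set would close a cycle. Hence every
  vertex outside such a set has at most one neighbour in it, and by connectedness the whole
  tree arises from any root by repeatedly adding a pendant vertex. All structural facts about
  trees below are inductions along this growth.
\<close>

lemma tree_grow [consumes 1, case_names root leaf]:
  assumes t: "t \<in> V"
    and root: "P {t}"
    and leaf: "\<And>U u w. \<lbrakk>U \<subseteq> V; t \<in> U; w \<in> U; u \<in> V; u \<notin> U; N u \<inter> U = {w}; P U\<rbrakk>
                 \<Longrightarrow> P (insert u U)"
  shows "P V"
proof -
  interpret pair_graph T by (rule pair_graph_T)
  define J where "J U x y \<longleftrightarrow> (\<exists>p. apath x p y \<and> set (pawalk_verts x p) \<subseteq> U)" for U x y
  define C where "C U \<longleftrightarrow> U \<subseteq> V \<and> t \<in> U \<and> (\<forall>x\<in>U. \<forall>y\<in>U. J U x y \<or> J U y x)" for U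
  have no_cycle: False
    if "J U w w'" "w \<noteq> w'" "u \<notin> U" "w \<in> N u" "w' \<in> N u" for U w w' u
  proof -
    obtain p where p: "apath w p w'" "set (pawalk_verts w p) \<subseteq> U" using \<open>J U w w'\<close> J_def by auto
    have cas: "pcas w p w'" and arcs: "set p \<subseteq> parcs T" and dist: "distinct (pawalk_verts w p)"
      using p(1) by (auto simp: apath_def awalk_def)
    have ne: "p \<noteq> []" using cas \<open>w \<noteq> w'\<close> by auto
    have "w' \<in> N u \<longleftrightarrow> u \<in> N w'" by (rule nbhd_sym)
    then have arc: "(u, w) \<in> parcs T" "(w', u) \<in> parcs T"
      using that by (auto simp: arc_iff)
    let ?q = "(u, w) # p @ [(w', u)]"
    have "awalk u ?q u"
      unfolding awalk_def using arc arcs pawalk_snoc[OF cas, of u] in_arcsD1[OF arc(1)] by simp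
    moreover have "distinct (tl (pawalk_verts u ?q))"
      using dist p(2) \<open>u \<notin> U\<close> by (auto simp: pawalk_verts_snoc[OF cas])
    ultimately have "cycle ?q" by (auto simp: cycle_def)
    moreover have "3 \<le> length ?q" using ne by (cases p) auto
    ultimately show False using tree by (auto simp: undirected_tree_def)
  qed
  have "\<exists>U. C U \<and> P U \<and> card U = Suc n" if "Suc n \<le> card V" for n
    using that
  proof (induction n)
    case 0
    have "J {t} t t" using t by (auto simp: J_def apath_Nil_iff intro!: exI[of _ "[]"])
    then show ?case using t root by (intro exI[of _ "{t}"]) (auto simp: C_def)
  next
    case (Suc n)
    then obtain U where U: "C U" "P U" "card U = Suc n" by auto
    then have "U \<subseteq> V" "t \<in> U" "U \<noteq> V" using Suc.prems by (auto simp: C_def)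
    then obtain w u where wu: "w \<in> U" "u \<in> V - U" "u \<in> N w" by (rule edge_leaving)
    have uw: "w \<in> N u" using wu nbhd_sym by auto
    have only: "N u \<inter> U = {w}"
    proof -
      have "w' = w" if "w' \<in> N u" "w' \<in> U" for w'
      proof (rule ccontr)
        assume "w' \<noteq> w"
        have "J U w w' \<or> J U w' w" using U(1) wu(1) that(2) unfolding C_def by blast
        then show False using no_cycle[of U w w' u] no_cycle[of U w' w u] \<open>w' \<noteq> w\<close> wu(2) uw that(1)
          by auto
      qed
      then show ?thesis using uw wu(1) by blast
    qed
    have P: "P (insert u U)" using leaf[OF \<open>U \<subseteq> V\<close> \<open>t \<in> U\<close> wu(1) _ _ only U(2)] wu(2) by simp
    have Jmono: "J (insert u U) x y" if "J U x y" for x y using that by (auto simp: J_def)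
    have Jself: "J (insert u U) u u"
      using wu by (auto simp: J_def apath_Nil_iff intro!: exI[of _ "[]"])
    have Ju: "J (insert u U) u y \<or> J (insert u U) y u" if "y \<in> U" for y
    proof -
      have "J U w y \<or> J U y w" using U(1) wu(1) that unfolding C_def by blast
      then show ?thesis
      proof
        assume "J U w y"
        then obtain p where p: "apath w p y" "set (pawalk_verts w p) \<subseteq> U" by (auto simp: J_def)
        have "apath u ((u, w) # p) y" using p wu uw by (auto simp: apath_Cons_iff arc_iff)
        then show ?thesis using p by (force simp: J_def)
      next
        assume "J U y w"
        then obtain p where p: "apath y p w" "set (pawalk_verts y p) \<subseteq> U" by (auto simp: J_def)
        then have cas: "pcas y p w" by (auto simp: apath_def awalk_def)
        note vs = pawalk_verts_snoc[OF cas, of u]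
        have "apath y (p @ [(w, u)]) u"
          using p wu pawalk_snoc[OF cas, of u]
          unfolding apath_def awalk_def vs by (auto simp: arc_iff)
        then show ?thesis using p vs
          unfolding J_def by (intro disjI2 exI[of _ "p @ [(w, u)]"]) auto
      qed
    qed
    have "C (insert u U)"
      using U(1) Jmono Jself Ju wu unfolding C_def by blast
    moreover have "card (insert u U) = Suc (Suc n)"
      using U(3) wu finite_subset[OF \<open>U \<subseteq> V\<close> finite_V] by simp
    ultimately show ?case using P by blast
  qed
  moreover have "card V > 0" using t finite_V card_gt_0_iff by blast
  ultimately obtain U where "C U" "P U" "card U = card V"
    by (metis Suc_pred le_refl)
  then show ?thesis using card_subset_eq[OF finite_V] by (auto simp: C_def)
qed

definition level :: "'a \<Rightarrow> ('a \<Rightarrow> nat) \<Rightarrow> bool" where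
  "level t d \<longleftrightarrow> d t = 0 \<and> (\<forall>x\<in>V. \<forall>y\<in>N x. d y = Suc (d x) \<or> d x = Suc (d y))
     \<and> (\<forall>x\<in>V - {t}. \<exists>!y. y \<in> N x \<and> d x = Suc (d y))"

lemma level_exists:
  assumes "t \<in> V"
  obtains d where "level t d"
proof -
  define Q where "Q U d \<longleftrightarrow> d t = 0 \<and> (\<forall>x\<in>U. \<forall>y\<in>N x \<inter> U. d y = Suc (d x) \<or> d x = Suc (d y))
    \<and> (\<forall>x\<in>U - {t}. \<exists>!y. y \<in> N x \<inter> U \<and> d x = Suc (d y))" for U and d :: "'a \<Rightarrow> nat"
  from assms have "\<exists>d. Q V d"
  proof (induction rule: tree_grow)
    case root
    show ?case by (rule exI[of _ "\<lambda>_. 0"]) (auto simp: Q_def nbhd_irrefl)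
  next
    case (leaf U u w)
    then obtain d where d: "Q U d" by blast
    define d' where "d' = d(u := Suc (d w))"
    have old: "d' x = d x" if "x \<in> U" for x using that leaf by (auto simp: d'_def)
    have nb: "x = w" if "x \<in> U" "u \<in> N x \<or> x \<in> N u" for x
      using that leaf(6) nbhd_sym by blast
    have "d' t = 0" using d old leaf by (auto simp: Q_def)
    moreover have "d' y = Suc (d' x) \<or> d' x = Suc (d' y)"
      if xy: "x \<in> insert u U" "y \<in> N x \<inter> insert u U" for x y
    proof -
      consider "x \<in> U" "y \<in> U" | "x = u" "y = w" | "x = w" "y = u"
        using xy nb nbhd_irrefl by blast
      then show ?thesis
      proof cases
        case 1 then show ?thesis using d xy old by (auto simp: Q_def)
      qed (use leaf old in \<open>auto simp: d'_def\<close>)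
    qed
    moreover have "\<exists>!y. y \<in> N x \<inter> insert u U \<and> d' x = Suc (d' y)"
      if x: "x \<in> insert u U - {t}" for x
    proof (cases "x = u")
      case True
      then have "N x \<inter> insert u U = {w}" using leaf nbhd_irrefl by auto
      moreover have "d' x = Suc (d' w)" using True leaf by (auto simp: d'_def)
      ultimately show ?thesis by auto
    next
      case False
      then have xU: "x \<in> U - {t}" using x by auto
      then have ex: "\<exists>!y. y \<in> N x \<inter> U \<and> d x = Suc (d y)" using d by (auto simp: Q_def)
      have "y \<in> N x \<inter> insert u U \<and> d' x = Suc (d' y) \<longleftrightarrow> y \<in> N x \<inter> U \<and> d x = Suc (d y)" for y
      proof (cases "y = u")
        case True
        then show ?thesis using xU nb[of x] leaf by (auto simp: d'_def)
      next
        case False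
        then show ?thesis using xU old by auto
      qed
      then show ?thesis using ex by simp
    qed
    ultimately have "Q (insert u U) d'" by (auto simp: Q_def)
    then show ?case by blast
  qed
  then obtain d where d: "Q V d" by blast
  have NV: "N x \<inter> V = N x" for x using nbhd_in_V by blast
  have "d t = 0" "\<forall>x\<in>V. \<forall>y\<in>N x. d y = Suc (d x) \<or> d x = Suc (d y)"
    "\<forall>x\<in>V - {t}. \<exists>!y. y \<in> N x \<and> d x = Suc (d y)"
    using d unfolding Q_def NV by blast+
  then show ?thesis using that by (simp add: level_def)
qed

lemma level_root: "level t d \<Longrightarrow> d t = 0"
  by (simp add: level_def)

lemma level_edge: "\<lbrakk>level t d; y \<in> N x\<rbrakk> \<Longrightarrow> d y = Suc (d x) \<or> d x = Suc (d y)"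
  using nbhd_in_V[of y x] by (simp add: level_def)

lemma level_parent:
  assumes "level t d" "x \<in> V" "x \<noteq> t"
  obtains y where "y \<in> N x" "d x = Suc (d y)"
  using assms unfolding level_def by blast

lemma level_parent_unique:
  assumes "level t d" "y \<in> N x" "z \<in> N x" "d x = Suc (d y)" "d x = Suc (d z)"
  shows "y = z"
proof -
  have "x \<in> V - {t}" using nbhd_in_V[OF assms(2)] level_root[OF assms(1)] assms(4) by auto
  then show ?thesis using assms unfolding level_def by blast
qed

lemma no_triangle:
  assumes "y \<in> N x" "z \<in> N y" "z \<in> N x"
  shows False
proof -
  obtain d where "level x d" using level_exists[of x] nbhd_in_V[OF assms(1)] by blast
  then show False
    using level_edge[of x d, OF _ assms(1)] level_edge[of x d, OF _ assms(2)]
      level_edge[of x d, OF _ assms(3)] by auto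
qed

text \<open>
  The map \<open>\<beta>\<close> sends a vertex to the neighbour of the root through which it is reached, so its
  fibres are the branches at the root. No edge joins two of them.
\<close>

lemma branch_exists:
  assumes "t \<in> V"
  obtains \<beta> where "\<And>a. a \<in> N t \<Longrightarrow> \<beta> a = a"
    "\<And>x y. \<lbrakk>y \<in> N x; x \<noteq> t; y \<noteq> t\<rbrakk> \<Longrightarrow> \<beta> x = \<beta> y"
proof -
  define Q where "Q U \<beta> \<longleftrightarrow> (\<forall>a\<in>N t \<inter> U. \<beta> a = a)
    \<and> (\<forall>x\<in>U - {t}. \<forall>y\<in>N x \<inter> (U - {t}). \<beta> x = \<beta> y)" for U and \<beta> :: "'a \<Rightarrow> 'a"
  from assms have "\<exists>\<beta>. Q V \<beta>"
  proof (induction rule: tree_grow)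
    case root
    show ?case by (rule exI[of _ id]) (auto simp: Q_def)
  next
    case (leaf U u w)
    then obtain \<beta> where \<beta>: "Q U \<beta>" by blast
    have nb: "x = w" if "x \<in> U" "u \<in> N x \<or> x \<in> N u" for x
      using that leaf(6) nbhd_sym by blast
    have "Q (insert u U) (\<beta>(u := if w = t then u else \<beta> w))"
      unfolding Q_def
    proof (intro conjI ballI)
      fix a assume a: "a \<in> N t \<inter> insert u U"
      show "(\<beta>(u := if w = t then u else \<beta> w)) a = a"
        using a \<beta> leaf nb[of t] by (auto simp: Q_def)
    next
      fix x y
      assume xy: "x \<in> insert u U - {t}" "y \<in> N x \<inter> (insert u U - {t})"
      then consider "x \<in> U" "y \<in> U" | "x = u" "y = w" | "x = w" "y = u"
        using nb nbhd_irrefl by blast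
      then show "(\<beta>(u := if w = t then u else \<beta> w)) x = (\<beta>(u := if w = t then u else \<beta> w)) y"
      proof cases
        case 1
        then have "x \<noteq> u" "y \<noteq> u" using leaf by auto
        then show ?thesis using 1 xy \<beta> by (auto simp: Q_def)
      qed (use xy leaf in auto)
    qed
    then show ?case by blast
  qed
  then obtain \<beta> where \<beta>: "Q V \<beta>" by blast
  show ?thesis
  proof (rule that[of \<beta>])
    show "\<beta> a = a" if "a \<in> N t" for a using \<beta> that nbhd_in_V by (auto simp: Q_def)
    show "\<beta> x = \<beta> y" if "y \<in> N x" "x \<noteq> t" "y \<noteq> t" for x y
      using \<beta> that nbhd_in_V[of y x] by (auto simp: Q_def)
  qed
qed

lemma leaf_avoiding:
  assumes "t \<in> V" "card V \<ge> 2"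
  obtains x w where "x \<noteq> t" "N x = {w}"
proof -
  from assms(1) have "V = {t} \<or> (\<exists>x\<in>V - {t}. \<exists>w. N x \<inter> V = {w})"
  proof (induction rule: tree_grow)
    case (leaf U u w)
    then have "N u \<inter> insert u U = {w}" using nbhd_irrefl by auto
    then show ?case using leaf by blast
  qed simp
  moreover have "V \<noteq> {t}" using assms by auto
  moreover have "N x \<inter> V = N x" for x using nbhd_in_V by blast
  ultimately show ?thesis using that by auto
qed

end

section \<open>Irredundant ve-dominating sets\<close>

text \<open>
  A minimal cover is one in which every member covers something that no other member covers.
  Unlike minimality itself, this can be verified member by member when covers of different parts
  are put together.
\<close>

lemma irredundant_cover:
  assumes "finite S" "\<forall>e\<in>E. \<exists>v\<in>S. R v e"
  obtains D where "D \<subseteq> S" "\<forall>e\<in>E. \<exists>v\<in>D. R v e"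
    "\<forall>v\<in>D. \<exists>e\<in>E. R v e \<and> (\<forall>u\<in>D - {v}. \<not> R u e)"
proof -
  have "\<exists>D\<subseteq>S. (\<forall>e\<in>E. \<exists>v\<in>D. R v e) \<and> (\<forall>v\<in>D. \<exists>e\<in>E. R v e \<and> (\<forall>u\<in>D - {v}. \<not> R u e))"
    using assms
  proof (induction S rule: finite_psubset_induct)
    case (psubset S)
    show ?case
    proof (cases "\<exists>v\<in>S. \<forall>e\<in>E. \<exists>u\<in>S - {v}. R u e")
      case True
      then obtain v where v: "v \<in> S" "\<forall>e\<in>E. \<exists>u\<in>S - {v}. R u e" by blast
      then have "S - {v} \<subset> S" by blast
      then obtain D where "D \<subseteq> S - {v}" "\<forall>e\<in>E. \<exists>v\<in>D. R v e"
        "\<forall>v\<in>D. \<exists>e\<in>E. R v e \<and> (\<forall>u\<in>D - {v}. \<not> R u e)"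
        using psubset.IH[of "S - {v}"] v(2) by blast
      then show ?thesis by blast
    next
      case False
      have "\<forall>v\<in>S. \<exists>e\<in>E. R v e \<and> (\<forall>u\<in>S - {v}. \<not> R u e)"
      proof
        fix v assume v: "v \<in> S"
        with False obtain e where e: "e \<in> E" "\<forall>u\<in>S - {v}. \<not> R u e" by auto
        moreover obtain u where "u \<in> S" "R u e" using psubset.prems e(1) by auto
        ultimately show "\<exists>e\<in>E. R v e \<and> (\<forall>u\<in>S - {v}. \<not> R u e)" by auto
      qed
      then show ?thesis using psubset.prems by (intro exI[of _ S]) simp
    qed
  qed
  then show ?thesis using that by blast
qed

context ve_tree
begin

abbreviation dom :: "'a \<Rightarrow> 'a \<times> 'a \<Rightarrow> bool" where "dom \<equiv> ve_dominates T"

definition covers :: "'a set \<Rightarrow> ('a \<times> 'a) set \<Rightarrow> bool" where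
  "covers D E \<longleftrightarrow> (\<forall>e\<in>E. \<exists>v\<in>D. dom v e)"

definition irredundant :: "'a set \<Rightarrow> ('a \<times> 'a) set \<Rightarrow> bool" where
  "irredundant D E \<longleftrightarrow> (\<forall>v\<in>D. \<exists>e\<in>E. dom v e \<and> (\<forall>u\<in>D - {v}. \<not> dom u e))"

definition inner_arcs :: "'a set \<Rightarrow> ('a \<times> 'a) set" where
  "inner_arcs U = {(x, y). x \<in> U \<and> y \<in> U \<and> y \<in> N x}"

lemma dom_iff: "dom v (x, y) \<longleftrightarrow> x = v \<or> y = v \<or> x \<in> N v \<or> y \<in> N v"
  by (auto simp: ve_dominates_def closed_nbhd_def)

lemma ve_dominating_iff: "ve_dominating T D \<longleftrightarrow> D \<subseteq> V \<and> covers D (parcs T)"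
  by (simp add: ve_dominating_def covers_def)

lemma obtain_irredundant:
  assumes "S \<subseteq> V" "covers S E"
  obtains D where "D \<subseteq> S" "covers D E" "irredundant D E"
proof -
  have "finite S" using assms finite_subset finite_V by blast
  from irredundant_cover[OF this, of E dom] assms(2)
  obtain D where "D \<subseteq> S" "\<forall>e\<in>E. \<exists>v\<in>D. dom v e"
    "\<forall>v\<in>D. \<exists>e\<in>E. dom v e \<and> (\<forall>u\<in>D - {v}. \<not> dom u e)"
    unfolding covers_def by blast
  then show ?thesis using that by (simp add: covers_def irredundant_def)
qed

lemma minimal_if_irredundant:
  assumes "D \<subseteq> V" "covers D (parcs T)" "irredundant D (parcs T)"
  shows "minimal_ve_dominating T D"
proof -
  have "\<not> covers D' (parcs T)" if sub: "D' \<subset> D" for D'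
  proof
    assume cov: "covers D' (parcs T)"
    obtain v where v: "v \<in> D" "v \<notin> D'" using sub by auto
    then obtain e where "e \<in> parcs T" "\<forall>u\<in>D - {v}. \<not> dom u e"
      using assms(3) unfolding irredundant_def by blast
    moreover have "D' \<subseteq> D - {v}" using sub v by auto
    ultimately show False using cov unfolding covers_def by blast
  qed
  then show ?thesis using assms by (auto simp: minimal_ve_dominating_def ve_dominating_iff)
qed

text \<open>
  The form in which being well-ve-dominated is refuted: exhibit an irredundant ve-dominating set
  and a smaller ve-dominating set.
\<close>

lemma well_card_le:
  assumes well: "well_ve_dominated T"
    and "D \<subseteq> V" "covers D (parcs T)" "irredundant D (parcs T)"
    and "D' \<subseteq> V" "covers D' (parcs T)"
  shows "card D \<le> card D'"
proof -
  obtain M where M: "M \<subseteq> D'" "covers M (parcs T)" "irredundant M (parcs T)"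
    using obtain_irredundant assms by metis
  have "card D = card M"
    using well minimal_if_irredundant[of D] minimal_if_irredundant[of M] assms M
    unfolding well_ve_dominated_def by blast
  also have "\<dots> \<le> card D'"
    using M(1) assms(5) finite_V by (meson card_mono finite_subset)
  finally show ?thesis .
qed

text \<open>
  An irredundant Y can be completed by members of A to an irredundant ve-dominating set, as
  long as no member of A touches the private edges of Y. The completion consists of vertices
  with private edges outside the reach of Y, and X together with the same completion is again
  ve-dominating. If all minimal ve-dominating sets have the same size, X cannot be smaller.
\<close>

lemma exchange:
  assumes well: "well_ve_dominated T"
    and sub: "Y \<subseteq> V" "A \<subseteq> V" "X \<subseteq> V"
    and cov: "\<And>x y. y \<in> N x \<Longrightarrow> \<exists>v\<in>Y \<union> A. dom v (x, y)"
    and private_edge: "\<And>y. y \<in> Y \<Longrightarrow>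
      \<exists>p q. q \<in> N p \<and> dom y (p, q) \<and> (\<forall>u\<in>(Y - {y}) \<union> A. \<not> dom u (p, q))"
    and repl: "\<And>v x y. \<lbrakk>v \<in> Y; y \<in> N x; dom v (x, y)\<rbrakk> \<Longrightarrow> \<exists>u\<in>X. dom u (x, y)"
  shows "card Y \<le> card X"
proof -
  define E where "E = {e \<in> parcs T. \<forall>v\<in>Y. \<not> dom v e}"
  have "covers A E" using cov by (fastforce simp: covers_def E_def nbhd_def)
  then obtain D where D: "D \<subseteq> A" "covers D E" "irredundant D E"
    using obtain_irredundant sub by metis
  have fin: "finite X" "finite Y" "finite D"
    using sub D finite_V by (meson finite_subset)+
  have disj: "Y \<inter> D = {}"
    using D(3) by (auto simp: irredundant_def E_def)
  have "covers (Y \<union> D) (parcs T)" using D(2) by (fastforce simp: covers_def E_def)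
  moreover have "irredundant (Y \<union> D) (parcs T)"
    unfolding irredundant_def
  proof
    fix v assume v: "v \<in> Y \<union> D"
    show "\<exists>e\<in>parcs T. dom v e \<and> (\<forall>u\<in>(Y \<union> D) - {v}. \<not> dom u e)"
    proof (cases "v \<in> Y")
      case True
      obtain p q where "q \<in> N p" "dom v (p, q)" "\<forall>u\<in>(Y - {v}) \<union> A. \<not> dom u (p, q)"
        using private_edge[OF True] by blast
      then show ?thesis using D(1) by (intro bexI[of _ "(p, q)"]) (auto simp: arc_iff)
    next
      case False
      then obtain e where "e \<in> E" "dom v e" "\<forall>u\<in>D - {v}. \<not> dom u e"
        using v D(3) by (auto simp: irredundant_def)
      then show ?thesis by (auto simp: E_def)
    qed
  qed
  moreover have "covers (X \<union> D) (parcs T)"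
    unfolding covers_def
  proof
    fix e assume e: "e \<in> parcs T"
    obtain x y where xy: "e = (x, y)" by (cases e)
    show "\<exists>v\<in>X \<union> D. dom v e"
    proof (cases "e \<in> E")
      case True then show ?thesis using D(2) by (auto simp: covers_def)
    next
      case False
      then obtain v where "v \<in> Y" "dom v e" using e by (auto simp: E_def)
      then show ?thesis using repl[of v y x] e xy by (auto simp: arc_iff)
    qed
  qed
  moreover have "Y \<union> D \<subseteq> V" "X \<union> D \<subseteq> V" using sub D by auto
  ultimately have "card (Y \<union> D) \<le> card (X \<union> D)" using well_card_le[OF well] by blast
  also have "card (X \<union> D) \<le> card X + card D" by (rule card_Un_le)
  finally show ?thesis using card_Un_disjoint[OF fin(2,3) disj] by simp
qed

text \<open>
  The edge ac is made private to a by using no other vertex that reaches it. The remaining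
  vertices still cover every edge that a does not reach: two adjacent vertices are not both
  neighbours of c, because there are no triangles.
\<close>

lemma irredundant_containing:
  assumes U: "U \<subseteq> V" and ac: "a \<in> U" "c \<in> U" "c \<in> N a"
  obtains X where "X \<subseteq> U" "a \<in> X" "covers X (inner_arcs U)" "irredundant X (inner_arcs U)"
proof -
  define S where "S = insert a (U - (N a \<union> N c \<union> {c}))"
  have "covers S (inner_arcs U)"
    unfolding covers_def
  proof
    fix e assume "e \<in> inner_arcs U"
    then obtain x y where e: "e = (x, y)" and xy: "x \<in> U" "y \<in> U" "y \<in> N x"
      by (auto simp: inner_arcs_def)
    have "\<not> (x \<in> N c \<and> y \<in> N c)" using xy(3) no_triangle by blast
    then have "dom a e \<or> x \<in> S \<or> y \<in> S" using xy ac by (auto simp: S_def e dom_iff)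
    then show "\<exists>v\<in>S. dom v e" by (auto simp: S_def e dom_iff)
  qed
  moreover have "S \<subseteq> V" using U ac by (auto simp: S_def)
  ultimately obtain X where X: "X \<subseteq> S" "covers X (inner_arcs U)" "irredundant X (inner_arcs U)"
    using obtain_irredundant by metis
  have "(a, c) \<in> inner_arcs U" using ac by (simp add: inner_arcs_def)
  then obtain v where "v \<in> X" "dom v (a, c)" using X(2) by (auto simp: covers_def)
  then have "a \<in> X" using X(1) nbhd_sym by (auto simp: S_def dom_iff)
  then show ?thesis using that[of X] X ac by (auto simp: S_def)
qed

lemma irredundant_avoiding_nbhd:
  assumes U: "U \<subseteq> V"
  obtains Y where "Y \<subseteq> U - N y" "covers Y (inner_arcs U)" "irredundant Y (inner_arcs U)"
proof -
  have "covers (U - N y) (inner_arcs U)"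
    unfolding covers_def
  proof
    fix e assume "e \<in> inner_arcs U"
    then obtain x z where e: "e = (x, z)" "x \<in> U" "z \<in> U" "z \<in> N x" by (auto simp: inner_arcs_def)
    then have "x \<in> U - N y \<or> z \<in> U - N y" using no_triangle by blast
    then show "\<exists>v\<in>U - N y. dom v e" unfolding e(1) dom_iff by blast
  qed
  then show ?thesis using obtain_irredundant[of "U - N y"] U that by blast
qed

text \<open>
  Deleting a support y and its leaf l separates the branch at a from the branch at b. Each
  of the two parts has irredundant covers that contain the neighbour of y and others that avoid
  it. A union of two covers ve-dominates the tree as soon as one of them contains a neighbour
  of y; otherwise the leaf has to be added, and it is not redundant. These four sizes cannot
  all agree.
\<close>

lemma well_support_le_one_inner_nbr:
  assumes well: "well_ve_dominated T" and l: "N l = {y}"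
    and ab: "a \<in> N y" "b \<in> N y" "a \<noteq> b"
    and inner: "c \<in> N a" "c \<noteq> y" "c' \<in> N b" "c' \<noteq> y"
  shows False
proof -
  have yV: "y \<in> V" and lV: "l \<in> V" using l nbhd_in_V by blast+
  have ly: "l \<in> N y" using l nbhd_sym by auto
  obtain \<beta> where \<beta>: "\<And>a. a \<in> N y \<Longrightarrow> \<beta> a = a"
    "\<And>x z. \<lbrakk>z \<in> N x; x \<noteq> y; z \<noteq> y\<rbrakk> \<Longrightarrow> \<beta> x = \<beta> z"
    using branch_exists[OF yV] by blast
  have only_y: "z = y" if "z \<in> N l \<or> l \<in> N z" for z using that l nbhd_sym by blast
  have ne: "a \<noteq> y" "b \<noteq> y" "a \<noteq> l" "b \<noteq> l" "c \<noteq> l" "c' \<noteq> l" "l \<noteq> y"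
    using ab inner only_y nbhd_irrefl ly by auto
  define U1 where "U1 = {x \<in> V - {y}. \<beta> x = a}"
  define U2 where "U2 = {x \<in> V - {y, l}. \<beta> x \<noteq> a}"
  have sub: "U1 \<subseteq> V" "U2 \<subseteq> V" by (auto simp: U1_def U2_def)
  have memb: "a \<in> U1" "c \<in> U1" "b \<in> U2" "c' \<in> U2"
    using ab inner ne \<beta>(1)[OF ab(1)] \<beta>(1)[OF ab(2)] \<beta>(2)[OF inner(1)] \<beta>(2)[OF inner(3)]
      nbhd_in_V[OF ab(1)] nbhd_in_V[OF ab(2)] nbhd_in_V[OF inner(1)] nbhd_in_V[OF inner(3)]
    by (auto simp: U1_def U2_def)
  have parts: "U1 \<inter> U2 = {}" "y \<notin> U1" "y \<notin> U2" "l \<notin> U1" "l \<notin> U2"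
    using \<beta>(1)[OF ly] ne by (auto simp: U1_def U2_def)
  have split: "x = y \<or> z = y \<or> (x, z) \<in> inner_arcs U1 \<union> inner_arcs U2" if "z \<in> N x" for x z
  proof -
    have "x \<in> V" "z \<in> V" "x = l \<longrightarrow> z = y" "z = l \<longrightarrow> x = y"
      using that only_y nbhd_in_V[OF that] by auto
    moreover have "x \<noteq> y \<longrightarrow> z \<noteq> y \<longrightarrow> \<beta> x = \<beta> z" using \<beta>(2)[OF that] by blast
    ultimately show ?thesis using that
      by (cases "\<beta> x = a") (auto simp: inner_arcs_def U1_def U2_def)
  qed
  have no_edge: "z \<notin> N x \<and> x \<notin> N z" if "x \<in> U1" "z \<in> U2" for x z
    using that \<beta>(2) by (fastforce simp: U1_def U2_def)
  have far: "\<not> dom x e" if "x \<in> U1 \<and> e \<in> inner_arcs U2 \<or> x \<in> U2 \<and> e \<in> inner_arcs U1" for x e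
    using that no_edge parts(1) by (auto simp: inner_arcs_def dom_iff)
  have inner_parcs: "inner_arcs U \<subseteq> parcs T" for U by (auto simp: inner_arcs_def nbhd_def)
  have irr: "irredundant (P \<union> Q) (inner_arcs U1 \<union> inner_arcs U2)"
    if PQ: "P \<subseteq> U1" "irredundant P (inner_arcs U1)" "Q \<subseteq> U2" "irredundant Q (inner_arcs U2)" for P Q
    unfolding irredundant_def
  proof
    fix v assume "v \<in> P \<union> Q"
    then consider "v \<in> P" | "v \<in> Q" by blast
    then show "\<exists>e\<in>inner_arcs U1 \<union> inner_arcs U2. dom v e \<and> (\<forall>u\<in>P \<union> Q - {v}. \<not> dom u e)"
    proof cases
      case 1
      then obtain e where "e \<in> inner_arcs U1" "dom v e" "\<forall>u\<in>P - {v}. \<not> dom u e"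
        using PQ(2) by (auto simp: irredundant_def)
      moreover have "\<not> dom u e" if "u \<in> Q" for u
        using far[of u e] that \<open>Q \<subseteq> U2\<close> \<open>e \<in> inner_arcs U1\<close> by blast
      ultimately show ?thesis by blast
    next
      case 2
      then obtain e where "e \<in> inner_arcs U2" "dom v e" "\<forall>u\<in>Q - {v}. \<not> dom u e"
        using PQ(4) by (auto simp: irredundant_def)
      moreover have "\<not> dom u e" if "u \<in> P" for u
        using far[of u e] that \<open>P \<subseteq> U1\<close> \<open>e \<in> inner_arcs U2\<close> by blast
      ultimately show ?thesis by blast
    qed
  qed
  have irr_mono: "irredundant P (parcs T)"
    if "irredundant P (inner_arcs U1 \<union> inner_arcs U2)" for P
    using that inner_parcs[of U1] inner_parcs[of U2] unfolding irredundant_def by blast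
  have cov: "covers (P \<union> Q) (parcs T)"
    if "covers P (inner_arcs U1)" "covers Q (inner_arcs U2)" "w \<in> P \<union> Q" "w \<in> N y" for P Q w
    unfolding covers_def
  proof
    fix e assume "e \<in> parcs T"
    then obtain x z where e: "e = (x, z)" "z \<in> N x" by (cases e) (auto simp: nbhd_def)
    show "\<exists>v\<in>P \<union> Q. dom v e"
    proof (cases "x = y \<or> z = y")
      case True
      then have "dom w e" using that(4) nbhd_sym[of y w] e by (auto simp: dom_iff)
      then show ?thesis using that by blast
    next
      case False
      then show ?thesis using split[OF e(2)] that e by (auto simp: covers_def)
    qed
  qed
  obtain X1 where X1: "X1 \<subseteq> U1" "a \<in> X1" "covers X1 (inner_arcs U1)" "irredundant X1 (inner_arcs U1)"
    using irredundant_containing[OF sub(1) memb(1,2) inner(1)] by blast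
  obtain X2 where X2: "X2 \<subseteq> U2" "b \<in> X2" "covers X2 (inner_arcs U2)" "irredundant X2 (inner_arcs U2)"
    using irredundant_containing[OF sub(2) memb(3,4) inner(3)] by blast
  obtain Y1 where Y1: "Y1 \<subseteq> U1 - N y" "covers Y1 (inner_arcs U1)" "irredundant Y1 (inner_arcs U1)"
    using irredundant_avoiding_nbhd[OF sub(1)] by blast
  obtain Y2 where Y2: "Y2 \<subseteq> U2 - N y" "covers Y2 (inner_arcs U2)" "irredundant Y2 (inner_arcs U2)"
    using irredundant_avoiding_nbhd[OF sub(2)] by blast
  have fin: "finite P" if "P \<subseteq> U1 \<or> P \<subseteq> U2" for P
    using that sub finite_V by (meson finite_subset)
  have card_Un: "card (P \<union> Q) = card P + card Q" if "P \<subseteq> U1" "Q \<subseteq> U2" for P Q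
    using that parts(1) fin by (intro card_Un_disjoint) auto
  have Y_sub: "Y1 \<subseteq> U1" "Y2 \<subseteq> U2" using Y1 Y2 by auto
  show False
  proof (cases "card X1 \<le> card Y1")
    case True
    let ?D = "insert l (Y1 \<union> Y2)"
    have l_reach: "dom l (x, z) \<longleftrightarrow> x \<in> {l, y} \<or> z \<in> {l, y}" for x z using l by (auto simp: dom_iff)
    have "covers ?D (parcs T)"
      unfolding covers_def
    proof
      fix e assume "e \<in> parcs T"
      then obtain x z where e: "e = (x, z)" "z \<in> N x" by (cases e) (auto simp: nbhd_def)
      show "\<exists>v\<in>?D. dom v e"
        using split[OF e(2)] Y1(2) Y2(2) l_reach e by (auto simp: covers_def)
    qed
    moreover have "irredundant ?D (parcs T)"
      unfolding irredundant_def
    proof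
      fix v assume v: "v \<in> ?D"
      show "\<exists>e\<in>parcs T. dom v e \<and> (\<forall>u\<in>?D - {v}. \<not> dom u e)"
      proof (cases "v = l")
        case True
        have "\<not> dom u (y, l)" if "u \<in> Y1 \<union> Y2" for u
          using that Y1 Y2 parts only_y nbhd_sym[of y u] by (auto simp: dom_iff)
        then show ?thesis using True ly by (intro bexI[of _ "(y, l)"]) (auto simp: arc_iff dom_iff)
      next
        case False
        then obtain e where e: "e \<in> inner_arcs U1 \<union> inner_arcs U2" "dom v e"
          "\<forall>u\<in>Y1 \<union> Y2 - {v}. \<not> dom u e"
          using v irr[OF Y_sub(1) Y1(3) Y_sub(2) Y2(3)] unfolding irredundant_def by blast
        then have "\<not> dom l e" using l_reach parts by (auto simp: inner_arcs_def)
        then show ?thesis using e inner_parcs by blast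
      qed
    qed
    moreover have "?D \<subseteq> V" using Y_sub sub lV by auto
    moreover have "covers (X1 \<union> Y2) (parcs T)" using cov[OF X1(3) Y2(2), of a] X1 ab by auto
    moreover have "X1 \<union> Y2 \<subseteq> V" using X1 Y_sub sub by auto
    ultimately have "card ?D \<le> card (X1 \<union> Y2)" using well_card_le[OF well] by blast
    moreover have "card ?D = Suc (card Y1 + card Y2)"
      using card_Un[OF Y_sub] Y_sub parts fin by (subst card_insert_disjoint) auto
    ultimately show False using card_Un[OF X1(1) Y_sub(2)] True by simp
  next
    case False
    have "covers (X1 \<union> X2) (parcs T)" using cov[OF X1(3) X2(3), of a] X1 ab by auto
    moreover have "irredundant (X1 \<union> X2) (parcs T)"
      using irr_mono[OF irr[OF X1(1,4) X2(1,4)]] .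
    moreover have "covers (Y1 \<union> X2) (parcs T)" using cov[OF Y1(2) X2(3), of b] X2 ab by auto
    moreover have "X1 \<union> X2 \<subseteq> V" "Y1 \<union> X2 \<subseteq> V" using X1 X2 Y_sub sub by auto
    ultimately have "card (X1 \<union> X2) \<le> card (Y1 \<union> X2)" using well_card_le[OF well] by blast
    then show False using card_Un[OF X1(1) X2(1)] card_Un[OF Y_sub(1) X2(1)] False by simp
  qed
qed

section \<open>Isolating sets from levels modulo three\<close>

text \<open>
  An edge survives the deletion of the closed neighbourhoods if and only if it has no endpoint in
  any of them.
\<close>

lemma isolating_iff: "isolating T D \<longleftrightarrow> D \<subseteq> V \<and> covers D (parcs T)"
proof -
  have "x \<in> V \<and> y \<in> V" if "(x, y) \<in> parcs T" for x y
    using that nbhd_in_V[of y x] by (simp add: nbhd_def)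
  then have "arcs (T \<restriction> (V - (\<Union>v\<in>D. closed_nbhd T v))) = {e \<in> parcs T. \<forall>v\<in>D. \<not> dom v e}"
    by (auto simp: ve_dominates_def)
  then show ?thesis by (auto simp: isolating_def covers_def)
qed

lemma isolation_number_le:
  assumes "D \<subseteq> V" "covers D (parcs T)"
  shows "isolation_number T \<le> card D"
proof -
  have "{D. isolating T D} \<subseteq> Pow V" by (auto simp: isolating_iff)
  then have "finite {D. isolating T D}" using finite_V by (meson finite_Pow_iff finite_subset)
  then show ?thesis using assms by (auto simp: isolation_number_def isolating_iff)
qed

definition third_lower_bound :: bool where
  "third_lower_bound \<longleftrightarrow> (\<forall>D\<subseteq>V. covers D (parcs T) \<longrightarrow> card V \<le> 3 * card D)"

text \<open>
  Group the vertices outside R by the value of d modulo three. Each of the three groups together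
  with X is isolating, and the total size of these sets is at most |V| - |R| + 3 |X|. If every
  isolating set has at least |V| / 3 elements, then |R| cannot exceed 3 |X|.
\<close>

lemma three_classes:
  fixes d :: "'a \<Rightarrow> nat"
  assumes bound: "third_lower_bound"
    and sub: "R \<subseteq> V" "X \<subseteq> V"
    and cov: "\<And>x y c. \<lbrakk>y \<in> N x; c < 3\<rbrakk> \<Longrightarrow> \<exists>v. dom v (x, y) \<and> (v \<in> X \<or> v \<in> V - R \<and> d v mod 3 = c)"
  shows "card R \<le> 3 * card X"
proof -
  define K where "K c = {v \<in> V - R. d v mod 3 = c}" for c
  have "card V \<le> 3 * (card X + card (K c))" if "c < 3" for c
  proof -
    have "covers (X \<union> K c) (parcs T)"
      using cov[OF _ that] unfolding covers_def K_def by (auto simp: arc_iff) blast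
    moreover have "X \<union> K c \<subseteq> V" using sub by (auto simp: K_def)
    ultimately have "card V \<le> 3 * card (X \<union> K c)" using bound by (simp add: third_lower_bound_def)
    also have "\<dots> \<le> 3 * (card X + card (K c))" by (intro mult_le_mono2 card_Un_le)
    finally show ?thesis .
  qed
  from this[of 0] this[of 1] this[of 2]
  have "card V \<le> 3 * card X + (card (K 0) + card (K 1) + card (K 2))" by simp
  also have "card (K 0) + card (K 1) + card (K 2) = card (\<Union>c\<in>{0, 1, 2}. K c)"
  proof -
    have "finite (K c)" for c using finite_V by (auto simp: K_def)
    then have "card (\<Union>c\<in>{0, 1, 2}. K c) = (\<Sum>c\<in>{0, 1, 2::nat}. card (K c))"
      by (intro card_UN_disjoint) (auto simp: K_def)
    then show ?thesis by simp
  qed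
  also have "(\<Union>c\<in>{0, 1, 2}. K c) = V - R"
  proof -
    have "n mod 3 \<in> {0, 1, 2}" for n :: nat by auto
    then show ?thesis by (auto simp: K_def)
  qed
  also have "card (V - R) = card V - card R"
    using sub finite_V by (meson card_Diff_subset finite_subset)
  finally show ?thesis using card_mono[OF finite_V sub(1)] by linarith
qed

lemma dom_swap: "dom v (x, y) \<longleftrightarrow> dom v (y, x)"
  by (auto simp: dom_iff)

lemma consecutive_mod3:
  fixes c n :: nat
  shows "c < 3 \<Longrightarrow> n mod 3 = c \<or> Suc n mod 3 = c \<or> Suc (Suc n) mod 3 = c"
  by (auto simp: mod_Suc)

lemma leaf_nbr_has_other_nbr:
  assumes "card V \<ge> 3" "N x = {y}"
  obtains z where "z \<in> N y" "z \<noteq> x"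
proof -
  have V: "x \<in> V" "y \<in> V" using assms nbhd_in_V by blast+
  have "card {x, y} \<le> 2" by (simp add: card_insert_if)
  then have "{x, y} \<noteq> V" using assms by auto
  moreover have "{x, y} \<subseteq> V" "x \<in> {x, y}" using V by auto
  ultimately obtain w u where wu: "w \<in> {x, y}" "u \<in> V - {x, y}" "u \<in> N w"
    using edge_leaving[of "{x, y}" x] by metis
  then have "w = y" using assms(2) by auto
  then show ?thesis using that[of u] wu by simp
qed

text \<open>
  Take levels from a root in X. An edge that is not incident with the root is reached from three
  consecutive levels: those of its endpoints and of the parent of the upper one. So the levels
  modulo three yield three isolating sets, in which X may stand in for R.
\<close>

lemma bound_dominated:
  assumes bound: "third_lower_bound"
    and sub: "R \<subseteq> V" "X \<subseteq> V" "t \<in> X"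
    and repl: "\<And>v x y. \<lbrakk>v \<in> R; y \<in> N x; dom v (x, y)\<rbrakk> \<Longrightarrow> \<exists>u\<in>X. dom u (x, y)"
  shows "card R \<le> 3 * card X"
proof -
  have "t \<in> V" using sub by auto
  obtain d where d: "level t d" using level_exists[OF \<open>t \<in> V\<close>] by blast
  note edge = level_edge[OF d] and parent = level_parent[OF d]
  have *: "\<exists>v. dom v (x, y) \<and> (v \<in> X \<or> v \<in> V - R \<and> d v mod 3 = c)"
    if xy: "y \<in> N x" "d y = Suc (d x)" and c: "c < 3" for x y c
  proof (cases "\<exists>v\<in>X. dom v (x, y)")
    case False
    then have "x \<noteq> t" using sub(3) by (auto simp: dom_iff)
    then obtain w where w: "w \<in> N x" "d x = Suc (d w)" using parent nbhd_in_V[OF xy(1)] by metis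
    have "d w mod 3 = c \<or> d x mod 3 = c \<or> d y mod 3 = c"
      using consecutive_mod3[OF c, of "d w"] w(2) xy(2) by simp
    then obtain v where v: "v \<in> {w, x, y}" "d v mod 3 = c" by auto
    have "dom v (x, y)" using v w(1) nbhd_sym[of w x] by (auto simp: dom_iff)
    moreover have "v \<in> V" using v(1) nbhd_in_V[OF w(1)] nbhd_in_V[OF xy(1)] by auto
    moreover have "v \<notin> R" using repl[OF _ xy(1) \<open>dom v (x, y)\<close>] False by auto
    ultimately show ?thesis using v by blast
  qed blast
  show ?thesis
  proof (rule three_classes[OF bound sub(1,2)])
    fix x y c assume xy: "y \<in> N x" and c: "c < (3::nat)"
    then have "x \<in> N y" using nbhd_sym by auto
    then show "\<exists>v. dom v (x, y) \<and> (v \<in> X \<or> v \<in> V - R \<and> d v mod 3 = c)"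
      using *[OF xy _ c] *[OF \<open>x \<in> N y\<close> _ c] edge[OF xy] dom_swap by blast
  qed
qed

text \<open>
  Rooted at a leaf other than l, the tree has its only edge at the root within reach of all three
  classes modulo three as well. A further child of y lies on the level of l and reaches every
  edge that l reaches. So l can be dropped from its class, and one of the three isolating sets has
  fewer than |V| / 3 elements.
\<close>

lemma bound_support_le_one_inner_nbr:
  assumes bound: "third_lower_bound"
    and large: "card V \<ge> 3" and l: "N l = {y}"
    and ab: "a \<in> N y" "b \<in> N y" "a \<noteq> b" "a \<noteq> l" "b \<noteq> l"
  shows False
proof -
  have ly: "l \<in> N y" using l nbhd_sym by auto
  have lV: "l \<in> V" "y \<in> V" using nbhd_in_V[OF ly] by auto
  obtain r w where r: "r \<noteq> l" "N r = {w}" using leaf_avoiding[OF lV(1)] large by auto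
  have rV: "r \<in> V" using r nbhd_in_V by blast
  obtain d where d: "level r d" using level_exists[OF rV] by blast
  note edge = level_edge[OF d] and parent = level_parent[OF d] and d0 = level_root[OF d]
  \<comment> \<open>At least one of a and b is a child of y and can stand in for l.\<close>
  have dl: "d l = Suc (d y)" using parent[OF lV(1), of "d l = Suc (d y)"] r(1) l by auto
  obtain y' where y': "y' \<in> N y" "y' \<noteq> l" "d y' = d l"
  proof (cases "y = r")
    case True
    then show ?thesis using that[of a] edge[OF ab(1)] ab d0 dl by auto
  next
    case False
    then have "d a = Suc (d y) \<or> d b = Suc (d y)"
      using level_parent_unique[OF d ab(1,2)] edge[OF ab(1)] edge[OF ab(2)] ab by blast
    then show ?thesis using that ab dl by metis
  qed
  have y_y': "y \<in> N y'" using y' nbhd_sym by auto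
  have y'V: "y' \<in> V" using nbhd_in_V[OF y_y'] by simp
  have *: "\<exists>v\<in>V - {l}. dom v (x, z) \<and> d v mod 3 = c"
    if xz: "z \<in> N x" "d z = Suc (d x)" and c: "c < 3" for x z c
  proof -
    have xzV: "x \<in> V" "z \<in> V" using nbhd_in_V[OF xz(1)] by auto
    have xl: "x \<noteq> l" using l xz dl by auto
    have sub: "\<exists>v\<in>V - {l}. dom v (x, z) \<and> d v = d v'"
      if v': "v' \<in> V" "dom v' (x, z)" "v' = l \<longrightarrow> dom y' (x, z)" for v'
      using v' y' y'V by (cases "v' = l") auto
    have zl: "dom y' (x, z)" if "z = l"
    proof -
      have "x = y" using that xz(1) l nbhd_sym[of z x] by auto
      then show ?thesis using y_y' by (simp add: dom_iff)
    qed
    show ?thesis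
    proof (cases "x = r")
      case False
      then obtain p where p: "p \<in> N x" "d x = Suc (d p)" using parent xzV by metis
      have "d p mod 3 = c \<or> d x mod 3 = c \<or> d z mod 3 = c"
        using consecutive_mod3[OF c, of "d p"] p(2) xz(2) by simp
      then obtain v where v: "v \<in> {p, x, z}" "d v mod 3 = c" by auto
      have xp: "x \<in> N p" using p nbhd_sym by auto
      have "p \<noteq> l" using xp l p(2) dl by auto
      then have "v = l \<longrightarrow> dom y' (x, z)" using v xl zl by auto
      moreover have "dom v (x, z)" using v xp by (auto simp: dom_iff)
      moreover have "v \<in> V" using v nbhd_in_V[OF p(1)] xzV by auto
      ultimately show ?thesis using sub v(2) by metis
    next
      case True
      then have zw: "z = w" using r xz by auto
      obtain h where h: "h \<in> N w" "h \<noteq> r" using leaf_nbr_has_other_nbr[OF large r(2)] by blast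
      have hV: "h \<in> V" using nbhd_in_V[OF h(1)] by simp
      have "d h \<noteq> 0" using parent[OF hV h(2), of "d h \<noteq> 0"] by auto
      then have dh: "d h = 2" using edge[OF h(1)] xz zw True d0 by auto
      have wh: "w \<in> N h" using h nbhd_sym by auto
      have "dom y' (x, z)" if "h = l"
        using that wh l zw y_y' by (auto simp: dom_iff)
      moreover have "dom h (x, z)" using wh zw by (auto simp: dom_iff)
      ultimately have "\<exists>v\<in>V - {l}. dom v (x, z) \<and> d v = 2" using sub[OF hV] dh by auto
      moreover have "\<exists>v\<in>V - {l}. dom v (x, z) \<and> d v = 1"
        using sub[OF xzV(2)] zl xz True d0 by (auto simp: dom_iff)
      moreover have "\<exists>v\<in>V - {l}. dom v (x, z) \<and> d v = 0"
        using xl True d0 rV by (auto simp: dom_iff)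
      moreover have "c = 0 \<or> c = 1 \<or> c = 2" using c by auto
      ultimately show ?thesis by (metis mod_less numeral_2_eq_2 numeral_3_eq_3 lessI less_SucI One_nat_def zero_less_Suc)
    qed
  qed
  have "card {l} \<le> 3 * card ({} :: 'a set)"
  proof (rule three_classes[OF bound, where d = d])
    fix x z c assume xz: "z \<in> N x" and c: "c < (3::nat)"
    then have "x \<in> N z" using nbhd_sym by auto
    then show "\<exists>v. dom v (x, z) \<and> (v \<in> {} \<or> v \<in> V - {l} \<and> d v mod 3 = c)"
      using *[OF xz _ c] *[OF \<open>x \<in> N z\<close> _ c] edge[OF xz] dom_swap by blast
  qed (use lV in auto)
  then show False by simp
qed

section \<open>Pendant paths at distinct vertices\<close>

lemma dom_pendant_edge:
  assumes "N l = {s}" "N s = {v, l}"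
  shows "dom u (s, l) \<longleftrightarrow> u \<in> {v, s, l}"
proof -
  have "s \<in> N u \<longleftrightarrow> u \<in> {v, l}" "l \<in> N u \<longleftrightarrow> u \<in> {s}"
    using nbhd_sym[of s u] nbhd_sym[of l u] assms by auto
  then show ?thesis by (auto simp: dom_iff)
qed

text \<open>
  Two pendant paths at v are served by v alone: this is one vertex in place of five in the count by
  levels, and in place of the two supports in a minimal ve-dominating set.
\<close>

lemma bound_two_pendant_paths:
  assumes bound: "third_lower_bound"
    and "N l = {s}" "N s = {v, l}" "N l' = {s'}" "N s' = {v, l'}"
    and "distinct [v, s, l, s', l']"
  shows False
proof -
  have nb: "s \<in> N v" "s' \<in> N v" using assms(2-5) nbhd_sym by blast+
  have V: "v \<in> V" "s \<in> V" "l \<in> V" "s' \<in> V" "l' \<in> V"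
    using assms(2-5) nbhd_in_V by blast+
  have "card {v, s, l, s', l'} \<le> 3 * card {v}"
  proof (rule bound_dominated[OF bound, where t = v])
    fix u x y assume "u \<in> {v, s, l, s', l'}" and xy: "y \<in> N x" and "dom u (x, y)"
    then show "\<exists>u\<in>{v}. dom u (x, y)"
      using assms(2-5) nb nbhd_sym[of y x] by (auto simp: dom_iff)
  qed (use V in auto)
  then show False using assms(6) by simp
qed

text \<open>
  Two adjacent supports of degree two span a component, a path on four vertices. One support
  suffices for it, but the two leaves form a minimal ve-dominating set as well.
\<close>

lemma bound_adjacent_supports:
  assumes bound: "third_lower_bound"
    and "N l = {s}" "N s = {s', l}" "N l' = {s'}" "N s' = {s, l'}"
    and "distinct [l, s, s', l']"
  shows False
proof -
  have V: "s \<in> V" "l \<in> V" "s' \<in> V" "l' \<in> V" using assms(2-5) nbhd_in_V by blast+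
  have "card {l, s, s', l'} \<le> 3 * card {s}"
  proof (rule bound_dominated[OF bound, where t = s])
    fix u x y assume "u \<in> {l, s, s', l'}" and xy: "y \<in> N x" and "dom u (x, y)"
    then show "\<exists>u\<in>{s}. dom u (x, y)"
      using assms(2-5) nbhd_sym[of y x] by (auto simp: dom_iff)
  qed (use V in auto)
  then show False using assms(6) by simp
qed

lemma well_two_pendant_paths:
  assumes well: "well_ve_dominated T"
    and "N l = {s}" "N s = {v, l}" "N l' = {s'}" "N s' = {v, l'}"
    and "distinct [v, s, l, s', l']"
  shows False
proof -
  have nb: "s \<in> N v" "s' \<in> N v" using assms(2-5) nbhd_sym by blast+
  have V: "v \<in> V" "s \<in> V" "l \<in> V" "s' \<in> V" "l' \<in> V"
    using assms(2-5) nbhd_in_V by blast+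
  have "card {s, s'} \<le> card {v}"
  proof (rule exchange[OF well, where A = "V - {v, s, l, s', l'}"])
    fix x y assume xy: "y \<in> N x"
    show "\<exists>u\<in>{s, s'} \<union> (V - {v, s, l, s', l'}). dom u (x, y)"
    proof (cases "x \<in> {v, s, l, s', l'}")
      case True
      then show ?thesis using assms(2-5) by (auto simp: dom_iff)
    next
      case False
      then have "x \<in> V - {v, s, l, s', l'}" using nbhd_in_V[OF xy] by auto
      then show ?thesis by (auto simp: dom_iff)
    qed
  next
    fix u assume "u \<in> {s, s'}"
    then show "\<exists>p q. q \<in> N p \<and> dom u (p, q) \<and>
      (\<forall>u'\<in>{s, s'} - {u} \<union> (V - {v, s, l, s', l'}). \<not> dom u' (p, q))"
    proof
      assume "u = s"
      then show ?thesis
        using assms(2-6) dom_pendant_edge[of l s]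
        by (intro exI[of _ s] exI[of _ l]) auto
    next
      assume "u \<in> {s'}"
      then show ?thesis
        using assms(2-6) dom_pendant_edge[of l' s']
        by (intro exI[of _ s'] exI[of _ l']) auto
    qed
  next
    fix u x y assume "u \<in> {s, s'}" "y \<in> N x" "dom u (x, y)"
    then show "\<exists>u\<in>{v}. dom u (x, y)"
      using assms(2-5) nb nbhd_sym[of y x] by (auto simp: dom_iff)
  qed (use V in auto)
  then show False using assms(6) by simp
qed

lemma well_adjacent_supports:
  assumes well: "well_ve_dominated T"
    and "N l = {s}" "N s = {s', l}" "N l' = {s'}" "N s' = {s, l'}"
    and "distinct [l, s, s', l']"
  shows False
proof -
  have V: "s \<in> V" "l \<in> V" "s' \<in> V" "l' \<in> V" using assms(2-5) nbhd_in_V by blast+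
  have "card {l, l'} \<le> card {s}"
  proof (rule exchange[OF well, where A = "V - {l, s, s', l'}"])
    fix x y assume xy: "y \<in> N x"
    show "\<exists>u\<in>{l, l'} \<union> (V - {l, s, s', l'}). dom u (x, y)"
    proof (cases "x \<in> {l, s, s', l'}")
      case True
      then show ?thesis using assms(2-5) by (auto simp: dom_iff)
    next
      case False
      then have "x \<in> V - {l, s, s', l'}" using nbhd_in_V[OF xy] by auto
      then show ?thesis by (auto simp: dom_iff)
    qed
  next
    fix u assume "u \<in> {l, l'}"
    then show "\<exists>p q. q \<in> N p \<and> dom u (p, q) \<and>
      (\<forall>u'\<in>{l, l'} - {u} \<union> (V - {l, s, s', l'}). \<not> dom u' (p, q))"
    proof
      assume "u = l"
      then show ?thesis
        using assms(2-6) dom_pendant_edge[of l s]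
        by (intro exI[of _ s] exI[of _ l]) auto
    next
      assume "u \<in> {l'}"
      then show ?thesis
        using assms(2-6) dom_pendant_edge[of l' s']
        by (intro exI[of _ s'] exI[of _ l']) auto
    qed
  next
    fix u x y assume "u \<in> {l, l'}" "y \<in> N x" "dom u (x, y)"
    then show "\<exists>u\<in>{s}. dom u (x, y)"
      using assms(2-5) nbhd_sym[of y x] by (auto simp: dom_iff)
  qed (use V in auto)
  then show False using assms(6) by simp
qed

end

section \<open>Vertices outside the pendant paths\<close>

text \<open>
  The situation reached once all supports have degree two and belong to different bases: every
  leaf l starts a pendant path l, s l, b l, and these paths are pairwise disjoint. The tree belongs
  to the family exactly if the set F of the remaining vertices is empty.
\<close>

locale pendant_tree = ve_tree +
  fixes L :: "'a set" and s b :: "'a \<Rightarrow> 'a"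
  assumes leaves: "L = {l. \<exists>y. N l = {y}}"
    and nbhd_leaf: "l \<in> L \<Longrightarrow> N l = {s l}"
    and nbhd_support: "l \<in> L \<Longrightarrow> N (s l) = {b l, l}"
    and inj_base: "inj_on b L"
    and base_not_support: "b ` L \<inter> s ` L = {}"
    and base_not_leaf: "b ` L \<inter> L = {}"
begin

definition F :: "'a set" where "F = V - (L \<union> s ` L \<union> b ` L)"

lemma sub: "L \<subseteq> V" "s ` L \<subseteq> V" "b ` L \<subseteq> V"
proof -
  have "l \<in> V \<and> s l \<in> V \<and> b l \<in> V" if "l \<in> L" for l
    using nbhd_leaf[OF that] nbhd_support[OF that] nbhd_in_V[of "s l" l] nbhd_in_V[of "b l" "s l"]
    by simp
  then show "L \<subseteq> V" "s ` L \<subseteq> V" "b ` L \<subseteq> V" by auto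
qed

lemma finite_L: "finite L"
  by (rule finite_subset[OF sub(1) finite_V])

lemma inj_support: "inj_on s L"
proof
  fix l l' assume l: "l \<in> L" "l' \<in> L" "s l = s l'"
  then have "{b l, l} = {b l', l'}" using nbhd_support[of l] nbhd_support[of l'] by simp
  then show "l = l'" using l base_not_leaf by (auto simp: doubleton_eq_iff)
qed

lemma support_not_leaf: "s ` L \<inter> L = {}"
proof -
  have "s l \<notin> L" if "l \<in> L" for l
    using that base_not_leaf nbhd_support[OF that] nbhd_leaf[of "s l"] by fastforce
  then show ?thesis by auto
qed

lemma card_base: "card (b ` L) = card L" and card_support: "card (s ` L) = card L"
  using inj_base inj_support by (auto intro: card_image)

lemma card_paths: "card (L \<union> s ` L \<union> b ` L) = 3 * card L"
proof -
  have "card (L \<union> s ` L \<union> b ` L) = card (L \<union> s ` L) + card (b ` L)"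
    using finite_L base_not_support base_not_leaf by (intro card_Un_disjoint) auto
  also have "card (L \<union> s ` L) = card L + card (s ` L)"
    using finite_L support_not_leaf by (intro card_Un_disjoint) auto
  finally show ?thesis by (simp add: card_base card_support)
qed

lemma nbhd_base: "l \<in> L \<Longrightarrow> s l \<in> N (b l)"
  using nbhd_support nbhd_sym[of "s l" "b l"] by auto

lemma dom_support_leaf: "l \<in> L \<Longrightarrow> dom u (s l, l) \<longleftrightarrow> u \<in> {b l, s l, l}"
  by (rule dom_pendant_edge) (simp_all add: nbhd_leaf nbhd_support)

lemma path_edge_dom_support:
  assumes "p \<in> L \<union> s ` L \<union> b ` L" "q \<in> N p"
  shows "\<exists>u\<in>s ` L. dom u (p, q)"
proof -
  obtain l where l: "l \<in> L" "p = l \<or> p = s l \<or> p = b l" using assms by auto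
  then have "dom (s l) (p, q)"
    using assms(2) nbhd_leaf[OF l(1)] nbhd_support[OF l(1)] by (auto simp: dom_iff)
  then show ?thesis using l by blast
qed

text \<open>
  The reach of a base contains the reach of its support and of its leaf. This is why the bases are
  the cheapest choice on the pendant paths, whereas a support only reaches edges that meet its own
  pendant path and leaves all edges inside F to other vertices.
\<close>

lemma path_dom_base:
  assumes "u \<in> L \<union> s ` L \<union> b ` L" "q \<in> N p" "dom u (p, q)"
  shows "\<exists>v\<in>b ` L. dom v (p, q)"
proof -
  obtain l where l: "l \<in> L" "u = l \<or> u = s l \<or> u = b l" using assms by auto
  have "p \<in> N q" using assms(2) nbhd_sym by auto
  then have "dom (b l) (p, q)"
    using assms(2,3) l nbhd_leaf[OF l(1)] nbhd_support[OF l(1)] nbhd_base[OF l(1)]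
    by (auto simp: dom_iff)
  then show ?thesis using l by blast
qed

lemma F_not_path: "x \<in> F \<Longrightarrow> l \<in> L \<Longrightarrow> x \<noteq> l \<and> x \<noteq> s l \<and> x \<noteq> b l"
  by (auto simp: F_def)

lemma nbhd_F: "x \<in> F \<Longrightarrow> N x \<subseteq> F \<union> b ` L"
proof
  fix z assume x: "x \<in> F" and z: "z \<in> N x"
  have xz: "x \<in> N z" using z nbhd_sym by auto
  have "z \<notin> L" using xz nbhd_leaf[of z] F_not_path[OF x, of z] by auto
  moreover have "z \<noteq> s l" if "l \<in> L" for l
    using xz nbhd_support[OF that] F_not_path[OF x that] by auto
  ultimately show "z \<in> F \<union> b ` L" using nbhd_in_V[OF z] by (auto simp: F_def)
qed

lemma F_not_singleton: "x \<in> F \<Longrightarrow> N x \<noteq> {y}"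
proof
  assume "x \<in> F" "N x = {y}"
  then have "x \<in> L" by (subst leaves) blast
  then show False using \<open>x \<in> F\<close> by (simp add: F_def)
qed

lemma F_boundary:
  assumes "F \<noteq> {}" "L \<noteq> {}"
  obtains u l where "u \<in> F" "l \<in> L" "b l \<in> N u"
proof -
  obtain l0 where "l0 \<in> L" using assms by auto
  have "V - F \<subseteq> V" "l0 \<in> V - F" "V - F \<noteq> V"
    using assms \<open>l0 \<in> L\<close> sub by (auto simp: F_def)
  then obtain w u where wu: "w \<in> V - F" "u \<in> V - (V - F)" "u \<in> N w" by (rule edge_leaving)
  then have u: "u \<in> F" "w \<in> N u" using nbhd_sym by auto
  then have "w \<in> b ` L" using nbhd_F wu(1) by auto
  then show ?thesis using that u by auto
qed

text \<open>
  Root the tree at a vertex t of F next to a base. The bases take care of the edges at t and of all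
  edges within reach of a pendant path. Every other edge within reach of t joins levels one and
  two, and it is also within reach of a vertex on level three. So t is dispensable for its class,
  in addition to all vertices on the pendant paths.
\<close>

lemma bound_no_rest:
  assumes bound: "third_lower_bound"
    and "L \<noteq> {}"
  shows "F = {}"
proof (rule ccontr)
  assume "F \<noteq> {}"
  then obtain t l where t: "t \<in> F" "l \<in> L" "b l \<in> N t" using F_boundary assms(2) by blast
  have tV: "t \<in> V" using t by (simp add: F_def)
  obtain d where d: "level t d" using level_exists[OF tV] by blast
  note edge = level_edge[OF d] and parent = level_parent[OF d] and d0 = level_root[OF d]
  define R where "R = insert t (L \<union> s ` L \<union> b ` L)"
  have *: "\<exists>v. dom v (x, z) \<and> (v \<in> b ` L \<or> v \<in> V - R \<and> d v mod 3 = c)"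
    if xz: "z \<in> N x" "d z = Suc (d x)" and c: "c < 3" for x z c
  proof (cases "\<exists>v\<in>L \<union> s ` L \<union> b ` L. dom v (x, z)")
    case True
    then show ?thesis using path_dom_base[OF _ xz(1)] by blast
  next
    case False
    then have "\<not> dom (b l) (x, z)" using t by auto
    then have xt: "x \<noteq> t" "z \<noteq> t" using t(3) nbhd_sym[of "b l" t] by (auto simp: dom_iff)
    have V: "x \<in> V" "z \<in> V" using nbhd_in_V[OF xz(1)] by auto
    obtain p where p: "p \<in> N x" "d x = Suc (d p)" using parent[OF V(1) xt(1)] .
    have "d p mod 3 = c \<or> d x mod 3 = c \<or> d z mod 3 = c"
      using consecutive_mod3[OF c, of "d p"] p(2) xz(2) by simp
    then obtain v where v: "v \<in> {p, x, z}" "d v mod 3 = c" by auto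
    have domv: "dom v (x, z)" using v p(1) nbhd_sym[of p x] by (auto simp: dom_iff)
    have vV: "v \<in> V" using v nbhd_in_V[OF p(1)] V by auto
    show ?thesis
    proof (cases "v = t")
      case False
      then have "v \<in> V - R" using \<open>\<not> (\<exists>v\<in>L \<union> s ` L \<union> b ` L. dom v (x, z))\<close> domv vV
        by (auto simp: R_def)
      then show ?thesis using v domv by blast
    next
      case True
      then have "v = p" using v xt by auto
      then have dz: "d z = 2" "c = 0" using True d0 p xz v by auto
      have "z \<notin> L" using False by (auto simp: dom_iff)
      moreover have xz': "x \<in> N z" using xz nbhd_sym by auto
      ultimately have "N z \<noteq> {x}" by (auto simp: leaves)
      then obtain h where h: "h \<in> N z" "h \<noteq> x" using xz' by blast
      then have "d z \<noteq> Suc (d h)" using level_parent_unique[OF d h(1) xz' _ xz(2)] by blast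
      then have dh: "d h = 3" using edge[OF h(1)] dz by simp
      have domh: "dom h (x, z)" using h nbhd_sym[of h z] by (auto simp: dom_iff)
      have "h \<noteq> t" using dh d0 by auto
      moreover have "h \<notin> L \<union> s ` L \<union> b ` L" using False domh by blast
      ultimately have "h \<in> V - R" using nbhd_in_V[OF h(1)] by (auto simp: R_def)
      moreover have "d h mod 3 = c" using dh dz by simp
      ultimately show ?thesis using domh by blast
    qed
  qed
  have "card R \<le> 3 * card (b ` L)"
  proof (rule three_classes[OF bound, where d = d])
    fix x z c assume xz: "z \<in> N x" and c: "c < (3::nat)"
    then have "x \<in> N z" using nbhd_sym by auto
    then show "\<exists>v. dom v (x, z) \<and> (v \<in> b ` L \<or> v \<in> V - R \<and> d v mod 3 = c)"
      using *[OF xz _ c] *[OF \<open>x \<in> N z\<close> _ c] edge[OF xz] dom_swap by blast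
  qed (use tV sub in \<open>auto simp: R_def\<close>)
  moreover have "card R = Suc (3 * card L)"
    unfolding R_def using t(1) finite_L by (simp add: card_paths F_def)
  ultimately show False by (simp add: card_base)
qed

lemma base_at_inner_leaf:
  assumes "x \<in> F" "N x \<inter> F = {y}"
  obtains l where "l \<in> L" "b l \<in> N x"
proof -
  have "N x \<noteq> {y}" "y \<in> N x" using F_not_singleton assms by auto
  then obtain z where "z \<in> N x" "z \<noteq> y" by blast
  then have "z \<in> b ` L" using nbhd_F[OF assms(1)] assms(2) by blast
  then show ?thesis using that \<open>z \<in> N x\<close> by auto
qed

text \<open>
  The supports form a ve-dominating set if F is independent. But then a vertex u of F next to a
  base can be added: after replacing the support on that pendant path by the leaf, the edge
  between u and the base is private to u, and the result is irredundant and larger.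
\<close>

lemma well_rest_edge:
  assumes well: "well_ve_dominated T" and "F \<noteq> {}" "L \<noteq> {}"
  obtains x y where "x \<in> F" "y \<in> F" "y \<in> N x"
proof -
  have False if indep: "\<And>x y. \<lbrakk>x \<in> F; y \<in> F\<rbrakk> \<Longrightarrow> y \<notin> N x"
  proof -
    obtain u l0 where u: "u \<in> F" "l0 \<in> L" "b l0 \<in> N u" using F_boundary assms by blast
    have uV: "u \<in> V" using u by (simp add: F_def)
    have nu: "N u \<subseteq> b ` L" using nbhd_F[OF u(1)] indep[OF u(1)] by blast
    define S where "S = s ` (L - {l0})"
    have S: "x \<in> S \<longleftrightarrow> (\<exists>l\<in>L. l \<noteq> l0 \<and> x = s l)" for x by (auto simp: S_def)
    have endpoint: "p \<in> L \<union> s ` L \<union> b ` L \<or> q \<in> L \<union> s ` L \<union> b ` L" if "q \<in> N p" for p q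
      using indep[of p q] that nbhd_in_V[OF that] by (auto simp: F_def)
    \<comment> \<open>No completion is necessary: the enlarged set already reaches every edge.\<close>
    have "card (insert u (insert l0 S)) \<le> card (s ` L)"
    proof (rule exchange[OF well, where A = "{}"])
      fix p q assume pq: "q \<in> N p"
      have *: "\<exists>v\<in>insert u (insert l0 S). dom v (p, q)"
        if pq: "q \<in> N p" and p: "p \<in> L \<union> s ` L \<union> b ` L" for p q
      proof -
        obtain l where l: "l \<in> L" "p = l \<or> p = s l \<or> p = b l" using p by auto
        show ?thesis
        proof (cases "l = l0")
          case True
          then have "dom u (p, q) \<or> dom l0 (p, q)"
            using l u nbhd_leaf[OF u(2)] by (auto simp: dom_iff)
          then show ?thesis by blast
        next
          case False
          have "dom (s l) (p, q)"
            using l pq nbhd_leaf[OF l(1)] nbhd_support[OF l(1)] by (auto simp: dom_iff)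
          then show ?thesis using False l S by blast
        qed
      qed
      have "p \<in> N q" using pq nbhd_sym by auto
      then show "\<exists>v\<in>insert u (insert l0 S) \<union> {}. dom v (p, q)"
        using endpoint[OF pq] *[of q p] *[of p q] pq dom_swap by auto
    next
      fix v assume v: "v \<in> insert u (insert l0 S)"
      consider "v = u" | "v = l0" | l where "l \<in> L" "l \<noteq> l0" "v = s l" using v S by auto
      then show "\<exists>p q. q \<in> N p \<and> dom v (p, q) \<and>
        (\<forall>w\<in>insert u (insert l0 S) - {v} \<union> {}. \<not> dom w (p, q))"
      proof cases
        case 1
        have "\<not> dom l0 (u, b l0)"
          using nbhd_leaf[OF u(2)] F_not_path[OF u(1)] u(2) base_not_leaf base_not_support
          by (auto simp: dom_iff)
        moreover have "\<not> dom (s l) (u, b l0)" if "l \<in> L" "l \<noteq> l0" for l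
        proof -
          have "b l0 \<noteq> b l" using inj_base that u(2) by (auto dest: inj_onD)
          moreover have "b l0 \<noteq> s l" "b l0 \<noteq> l"
            using base_not_support base_not_leaf that u(2) by auto
          ultimately show ?thesis
            using nbhd_support[OF that(1)] F_not_path[OF u(1) that(1)] by (auto simp: dom_iff)
        qed
        ultimately have "\<not> dom w (u, b l0)" if "w \<in> insert u (insert l0 S) - {v} \<union> {}" for w
          using that 1 by (auto simp: S)
        moreover have "dom v (u, b l0)" using 1 by (simp add: dom_iff)
        ultimately show ?thesis using u(3) by blast
      next
        case 2
        have "u \<notin> {b l0, s l0, l0}" using F_not_path[OF u(1,2)] by auto
        moreover have "s l \<notin> {b l0, s l0, l0}" if "l \<in> L" "l \<noteq> l0" for l
          using that u(2) inj_onD[OF inj_support, of l l0] base_not_support support_not_leaf by blast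
        ultimately have "\<not> dom w (s l0, l0)" if "w \<in> insert u (insert l0 S) - {v} \<union> {}" for w
          using that 2 S dom_support_leaf[OF u(2), of w] by auto
        moreover have "dom v (s l0, l0)" "l0 \<in> N (s l0)"
          using 2 dom_support_leaf[OF u(2), of v] nbhd_support[OF u(2)] by auto
        ultimately show ?thesis by blast
      next
        case 3
        have nu: "\<not> dom u (s l, l)"
          using dom_support_leaf[OF 3(1)] F_not_path[OF u(1) 3(1)] by simp
        have nl: "\<not> dom l0 (s l, l)"
          using dom_support_leaf[OF 3(1)] 3 u(2) base_not_leaf support_not_leaf by auto
        have ns: "\<not> dom (s k) (s l, l)" if "k \<in> L" "s k \<noteq> s l" for k
          using dom_support_leaf[OF 3(1)] that 3(1) base_not_support support_not_leaf by auto
        have "\<not> dom w (s l, l)" if "w \<in> insert u (insert l0 S) - {v} \<union> {}" for w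
        proof -
          have "w = u \<or> w = l0 \<or> (\<exists>k\<in>L. w = s k \<and> s k \<noteq> s l)" using that 3 by (auto simp: S)
          then show ?thesis using nu nl ns by (elim disjE bexE conjE) simp_all
        qed
        moreover have "dom v (s l, l)" "l \<in> N (s l)"
          using 3 dom_support_leaf[OF 3(1), of v] nbhd_support[OF 3(1)] by auto
        ultimately show ?thesis by blast
      qed
    next
      fix v p q assume pq: "q \<in> N p"
      then have "p \<in> N q" using nbhd_sym by auto
      then show "\<exists>w\<in>s ` L. dom w (p, q)"
        using endpoint[OF pq] path_edge_dom_support[OF _ pq] path_edge_dom_support[of q p]
          dom_swap by blast
    qed (use uV u sub in \<open>auto simp: S_def\<close>)
    moreover have "card S = card L - 1"
      unfolding S_def using inj_support u(2) finite_L
      by (subst card_image) (auto intro: inj_on_subset)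
    moreover have "card (insert u (insert l0 S)) = Suc (Suc (card S))"
    proof -
      have "u \<noteq> l0" "u \<notin> S" "l0 \<notin> S"
        using F_not_path[OF u(1)] S u(2) support_not_leaf by auto
      then show ?thesis using finite_L by (simp add: S_def)
    qed
    moreover have "card L > 0" using u(2) finite_L card_gt_0_iff by blast
    ultimately show False by (simp add: card_support)
  qed
  then show ?thesis using that by blast
qed

text \<open>
  Among the vertices of F with a neighbour in F, let x have the greatest distance from the root,
  and let y be its neighbour in F, which is its parent. All neighbours of y in F, except possibly
  the parent z of y, have no other neighbour in F and are therefore adjacent to bases. Next to the
  supports, x and a further neighbour w of z in F can be given the private edges xy and zw. The
  bases, however, reach everything that the supports reach, and together with w they reach every
  edge at x or y. With bases in place of supports, x is superfluous.
\<close>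

lemma well_no_rest:
  assumes well: "well_ve_dominated T" and "L \<noteq> {}"
  shows "F = {}"
proof (rule ccontr)
  assume "F \<noteq> {}"
  then obtain x0 y0 where xy0: "x0 \<in> F" "y0 \<in> F" "y0 \<in> N x0"
    using well_rest_edge[OF well] assms by blast
  have FV: "F \<subseteq> V" by (auto simp: F_def)
  obtain d where d: "level x0 d" using level_exists xy0(1) FV by blast
  note edge = level_edge[OF d]
  define I where "I = {x \<in> F. N x \<inter> F \<noteq> {}}"
  have I: "finite I" "I \<noteq> {}"
    using finite_subset[OF FV finite_V] xy0 by (auto simp: I_def)
  then have "Max (d ` I) \<in> d ` I" by (intro Max_in) auto
  then obtain x where x: "x \<in> I" "d x = Max (d ` I)" by auto
  have top: "d q \<le> d x" if "q \<in> I" for q using I(1) that by (simp add: x(2))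
  have xF: "x \<in> F" using x by (simp add: I_def)
  have up: "d q = Suc (d p)" if "q \<in> F" "d q = d x" "p \<in> N q \<inter> F" for p q
  proof -
    have "q \<in> N p" using that(3) nbhd_sym by auto
    then have "p \<in> I" using that by (auto simp: I_def)
    then have "d p \<le> d q" using top that(2) by simp
    then show ?thesis using edge[of p q] that(3) by auto
  qed
  obtain y where y: "y \<in> N x" "y \<in> F" using x by (auto simp: I_def)
  have xy: "x \<in> N y" using y nbhd_sym by auto
  have single: "N q \<inter> F = {y}" if q: "q \<in> F" "q \<in> N y" "d q = d x" for q
  proof -
    have yq: "y \<in> N q" using q(2) nbhd_sym by auto
    have "p = y" if p: "p \<in> N q \<inter> F" for p
    proof (rule level_parent_unique[OF d _ yq])
      show "p \<in> N q" "d q = Suc (d p)" using p up[OF q(1,3)] by auto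
      show "d q = Suc (d y)" using yq y(2) up[OF q(1,3)] by auto
    qed
    then show ?thesis using yq y(2) by blast
  qed
  have nx: "N x \<inter> F = {y}" using single[OF xF xy] by simp
  have dx: "d x = Suc (d y)" using up[OF xF refl] y by blast
  \<comment> \<open>Z holds the parent z of y and W a further neighbour w of z in F; both are empty without such a w.\<close>
  obtain Z W where ZW: "Z = {} \<and> W = {} \<or>
      (\<exists>z w. Z = {z} \<and> W = {w} \<and> z \<in> N y \<inter> F \<and> w \<in> N z \<inter> F \<and> w \<noteq> y)"
    and rest: "\<And>q. q \<in> N y \<inter> F - Z \<Longrightarrow> N q \<inter> F = {y}"
  proof (cases "\<exists>z\<in>N y \<inter> F. d y = Suc (d z) \<and> N z \<inter> F \<noteq> {y}")
    case True
    then obtain z where z: "z \<in> N y \<inter> F" "d y = Suc (d z)" "N z \<inter> F \<noteq> {y}" by blast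
    then have "y \<in> N z \<inter> F" using y(2) nbhd_sym by auto
    then obtain w where "w \<in> N z \<inter> F" "w \<noteq> y" using z(3) by blast
    moreover have "N q \<inter> F = {y}" if "q \<in> N y \<inter> F - {z}" for q
    proof -
      have "d y \<noteq> Suc (d q)" using level_parent_unique[OF d, of q y z] that z by blast
      then have "d q = d x" using edge[of q y] that dx by auto
      then show ?thesis using single that by blast
    qed
    ultimately show ?thesis using that[of "{z}" "{w}"] z(1) by blast
  next
    case False
    have "N q \<inter> F = {y}" if "q \<in> N y \<inter> F" for q
    proof (cases "d y = Suc (d q)")
      case True
      then show ?thesis using False that by blast
    next
      case False
      then have "d q = d x" using edge[of q y] that dx by auto
      then show ?thesis using single that by blast
    qed
    then show ?thesis using that[of "{}" "{}"] by blast
  qed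
  have Z: "\<And>z. z \<in> Z \<Longrightarrow> z \<in> N y \<and> z \<in> F \<and> z \<noteq> x \<and> (\<exists>w\<in>W. w \<in> N z \<and> z \<in> N w)"
    using ZW nx nbhd_sym by blast
  have W: "\<And>w. w \<in> W \<Longrightarrow> w \<in> F \<and> w \<noteq> y \<and> w \<notin> N y \<and> (\<exists>z\<in>Z. w \<in> N z \<and> z \<in> N w)"
    using ZW no_triangle nbhd_sym by blast
  have Wx: "w \<noteq> x \<and> x \<notin> N w \<and> w \<notin> N x \<and> y \<notin> N w" if "w \<in> W" for w
    using W[OF that] Z nx xy nbhd_sym by blast
  have W1: "w = w'" if "w \<in> W" "w' \<in> W" for w w' using ZW that by blast
  \<comment> \<open>The vertices of F that do not reach the private edges of x and of w.\<close>
  define A where "A = F - (insert y (N y) \<union> (\<Union>v\<in>Z \<union> W. insert v (N v)))"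
  have A: "v \<in> F \<and> v \<noteq> y \<and> v \<notin> N y \<and> (\<forall>u\<in>Z \<union> W. v \<noteq> u \<and> v \<notin> N u \<and> u \<notin> N v)"
    if "v \<in> A" for v
    using that nbhd_sym by (auto simp: A_def)
  have sF: "s l \<notin> F \<and> N (s l) \<inter> F = {}" if "l \<in> L" for l
    using that nbhd_support[OF that] by (auto simp: F_def)
  have "card (insert x (W \<union> s ` L)) \<le> card (b ` L \<union> W)"
  proof (rule exchange[OF well, where A = A])
    have *: "\<exists>v\<in>insert x (W \<union> s ` L) \<union> A. dom v (p, q)"
      if pq: "q \<in> N p" and p: "p \<in> L \<union> s ` L \<union> b ` L" for p q
      using path_edge_dom_support[OF p pq] by blast
    fix p q assume pq: "q \<in> N p"
    then have qp: "p \<in> N q" using nbhd_sym by auto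
    consider "p \<notin> F" | "q \<notin> F" | "p \<in> F" "q \<in> F" by blast
    then show "\<exists>v\<in>insert x (W \<union> s ` L) \<union> A. dom v (p, q)"
    proof cases
      case 1
      then show ?thesis using *[OF pq] nbhd_in_V[OF pq] by (auto simp: F_def)
    next
      case 2
      then show ?thesis using *[OF qp] nbhd_in_V[OF pq] dom_swap by (auto simp: F_def)
    next
      case 3
      show ?thesis
      proof (cases "p = y \<or> q = y \<or> (\<exists>w\<in>W. dom w (p, q))")
        case True
        then show ?thesis using y(1) by (auto simp: dom_iff)
      next
        case False
        then have ne: "p \<noteq> y" "q \<noteq> y" "\<And>w. w \<in> W \<Longrightarrow> p \<noteq> w \<and> q \<noteq> w \<and> p \<notin> N w \<and> q \<notin> N w"
          by (auto simp: dom_iff)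
        then have nZ: "p \<notin> Z" "q \<notin> Z" using Z by blast+
        have "p \<notin> N y" "q \<notin> N y" using rest[of p] rest[of q] 3 nZ pq qp ne by blast+
        moreover have "(\<forall>z\<in>Z. p \<notin> N z) \<or> (\<forall>z\<in>Z. q \<notin> N z)"
          using ZW no_triangle pq by blast
        ultimately have "p \<in> A \<or> q \<in> A" using 3 ne nZ by (auto simp: A_def)
        then show ?thesis by (auto simp: dom_iff)
      qed
    qed
  next
    fix v assume v: "v \<in> insert x (W \<union> s ` L)"
    consider "v = x" | "v \<in> W" | l where "l \<in> L" "v = s l" using v by auto
    then show "\<exists>p q. q \<in> N p \<and> dom v (p, q) \<and>
      (\<forall>u\<in>insert x (W \<union> s ` L) - {v} \<union> A. \<not> dom u (p, q))"
    proof cases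
      case 1
      have "\<not> dom u (x, y)" if "u \<in> W" for u using Wx[OF that] W[OF that] by (auto simp: dom_iff)
      moreover have "\<not> dom u (x, y)" if "u \<in> s ` L" for u
        using that sF xF y(2) by (auto simp: dom_iff)
      moreover have "\<not> dom u (x, y)" if "u \<in> A" for u
        using A[OF that] xy nx nbhd_sym[of x u] nbhd_sym[of y u] by (auto simp: dom_iff)
      ultimately have "\<not> dom u (x, y)" if "u \<in> insert x (W \<union> s ` L) - {v} \<union> A" for u
        using that 1 by blast
      moreover have "dom v (x, y)" using 1 by (simp add: dom_iff)
      ultimately show ?thesis using y(1) by blast
    next
      case 2
      then obtain z where z: "z \<in> Z" "v \<in> N z" "z \<in> N v" using W by blast
      have "z \<in> F" "z \<noteq> x" "z \<noteq> y" using Z[OF z(1)] nbhd_irrefl[of y] by auto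
      then have "z \<notin> N x" using nx by blast
      then have "\<not> dom x (z, v)" using \<open>z \<noteq> x\<close> Wx[OF 2] by (simp add: dom_iff)
      moreover have "\<not> dom u (z, v)" if "u \<in> s ` L" for u
        using that sF Z[OF z(1)] W[OF 2] by (auto simp: dom_iff)
      moreover have "\<not> dom u (z, v)" if "u \<in> A" for u
        using A[OF that] z(1) 2 by (auto simp: dom_iff)
      ultimately have "\<not> dom u (z, v)" if "u \<in> insert x (W \<union> s ` L) - {v} \<union> A" for u
        using that W1[OF 2] by blast
      moreover have "dom v (z, v)" by (simp add: dom_iff)
      ultimately show ?thesis using z(2) by blast
    next
      case 3
      have "u \<notin> {b l, s l, l}" if "u \<in> F" for u using F_not_path[OF that 3(1)] by auto
      then have "u \<notin> {b l, s l, l}" if "u \<in> insert x W \<union> A" for u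
        using that xF W A by blast
      moreover have "s k \<notin> {b l, s l, l}" if "k \<in> L" "s k \<noteq> s l" for k
        using that 3 base_not_support support_not_leaf by blast
      ultimately have "\<not> dom u (s l, l)" if "u \<in> insert x (W \<union> s ` L) - {v} \<union> A" for u
        using that 3 dom_support_leaf[OF 3(1)] by blast
      moreover have "dom v (s l, l)" "l \<in> N (s l)"
        using 3 nbhd_support[OF 3(1)] by (auto simp: dom_iff)
      ultimately show ?thesis by blast
    qed
  next
    fix v p q assume v: "v \<in> insert x (W \<union> s ` L)" and pq: "q \<in> N p" and dv: "dom v (p, q)"
    have *: "\<exists>u\<in>b ` L \<union> W. dom u (p, q)" if pq: "q \<in> N p" and p: "p \<in> insert x (N x)" for p q
    proof -
      have leafy: "\<exists>u\<in>b ` L. r \<in> N u" if r: "r \<in> F" "N r \<inter> F = {y}" for r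
      proof -
        obtain k where "k \<in> L" "b k \<in> N r" by (rule base_at_inner_leaf[OF r])
        then show ?thesis using nbhd_sym[of "b k" r] by blast
      qed
      consider "p = x" | "p = y" | "p \<in> b ` L" using p nx nbhd_F[OF xF] by blast
      then show ?thesis
      proof cases
        case 1
        then show ?thesis using leafy[OF xF nx] by (auto simp: dom_iff)
      next
        case 2
        consider "q \<in> b ` L" | "q \<in> Z" | "q \<in> N y \<inter> F - Z" using pq 2 nbhd_F[OF y(2)] by blast
        then show ?thesis
        proof cases
          case 1
          then show ?thesis by (auto simp: dom_iff)
        next
          case 2
          then show ?thesis using Z by (auto simp: dom_iff)
        next
          case 3
          then show ?thesis using leafy[of q] rest[OF 3] by (auto simp: dom_iff)
        qed
      next
        case 3
        then show ?thesis by (auto simp: dom_iff)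
      qed
    qed
    have qp: "p \<in> N q" using pq nbhd_sym by auto
    consider "v = x" | "v \<in> W" | "v \<in> s ` L" using v by auto
    then show "\<exists>u\<in>b ` L \<union> W. dom u (p, q)"
    proof cases
      case 1
      then have "p \<in> insert x (N x) \<or> q \<in> insert x (N x)" using dv by (auto simp: dom_iff)
      then show ?thesis using *[OF pq] *[OF qp] dom_swap by blast
    next
      case 2
      then show ?thesis using dv by blast
    next
      case 3
      then show ?thesis using path_dom_base[OF _ pq dv] by blast
    qed
  qed (use FV xF W A sub in auto)
  moreover have "card (insert x (W \<union> s ` L)) = Suc (card W + card L)"
  proof -
    have "W \<inter> s ` L = {}" "x \<notin> W \<union> s ` L" using W Wx sF xF by auto
    moreover have "finite W" using ZW by auto
    ultimately show ?thesis using finite_L by (simp add: card_Un_disjoint card_support)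
  qed
  moreover have "card (b ` L \<union> W) \<le> card L + card W"
    using card_Un_le[of "b ` L" W] by (simp add: card_base)
  ultimately show False by simp
qed

end

context ve_tree
begin

text \<open>
  In a reduced tree with at least three vertices a support carries a single leaf, so its other
  neighbours are inner vertices, and the first condition leaves only one of them: the base.
\<close>

lemma pendant_tree_exists:
  assumes red: "reduced T" and large: "card V \<ge> 3"
    and two_inner: "\<And>l y a b c c'. \<lbrakk>N l = {y}; a \<in> N y; b \<in> N y; a \<noteq> b; a \<noteq> l; b \<noteq> l;
      c \<in> N a; c \<noteq> y; c' \<in> N b; c' \<noteq> y\<rbrakk> \<Longrightarrow> False"
    and two_paths: "\<And>l s v l' s'. \<lbrakk>N l = {s}; N s = {v, l}; N l' = {s'}; N s' = {v, l'};
      distinct [v, s, l, s', l']\<rbrakk> \<Longrightarrow> False"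
    and adjacent: "\<And>l s l' s'. \<lbrakk>N l = {s}; N s = {s', l}; N l' = {s'}; N s' = {s, l'};
      distinct [l, s, s', l']\<rbrakk> \<Longrightarrow> False"
  obtains L s b where "pendant_tree T L s b" "L \<noteq> {}"
proof -
  define L where "L = {l. \<exists>y. N l = {y}}"
  have inner: "\<exists>c\<in>N a. c \<noteq> y" if "N l = {y}" "a \<in> N y" "a \<noteq> l" for l y a
  proof (rule ccontr)
    assume "\<not> (\<exists>c\<in>N a. c \<noteq> y)"
    moreover have "y \<in> N a" using that nbhd_sym by auto
    ultimately have "N a = {y}" by blast
    then have "N a = N l" using that(1) by simp
    moreover have "a \<in> V" "l \<in> V" using nbhd_in_V[OF that(2)] nbhd_in_V[of y l] that by auto
    ultimately show False using red that(3) by (auto simp: reduced_def false_twins_def)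
  qed
  have "\<exists>p. N l = {fst p} \<and> N (fst p) = {snd p, l} \<and> snd p \<notin> L \<and> snd p \<noteq> l" if l: "l \<in> L" for l
  proof -
    obtain y where y: "N l = {y}" using l by (auto simp: L_def)
    obtain z where z: "z \<in> N y" "z \<noteq> l" by (rule leaf_nbr_has_other_nbr[OF large y])
    have ly: "l \<in> N y" using y nbhd_sym by auto
    have "x = z" if x: "x \<in> N y" "x \<noteq> l" for x
    proof (rule ccontr)
      assume "x \<noteq> z"
      obtain c c' where "c \<in> N x" "c \<noteq> y" "c' \<in> N z" "c' \<noteq> y"
        using inner[OF y x] inner[OF y z] by blast
      then show False by (rule two_inner[OF y x(1) z(1) \<open>x \<noteq> z\<close> x(2) z(2)])
    qed
    then have "N y = {z, l}" using z ly by blast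
    moreover have "z \<notin> L"
    proof
      assume "z \<in> L"
      moreover have "y \<in> N z" using z nbhd_sym by auto
      ultimately have "N z = {y}" by (auto simp: L_def)
      then show False using inner[OF y z] by simp
    qed
    ultimately show ?thesis using y z by (intro exI[of _ "(y, z)"]) simp
  qed
  then have "\<forall>l\<in>L. \<exists>p. N l = {fst p} \<and> N (fst p) = {snd p, l} \<and> snd p \<notin> L \<and> snd p \<noteq> l"
    by simp
  from bchoice[OF this] obtain f where f: "\<forall>l\<in>L. N l = {fst (f l)} \<and> N (fst (f l)) = {snd (f l), l}
      \<and> snd (f l) \<notin> L \<and> snd (f l) \<noteq> l"
    by (rule exE)
  define s where "s l = fst (f l)" for l
  define b where "b l = snd (f l)" for l
  have nl: "N l = {s l}" and nsl: "N (s l) = {b l, l}" and bL: "b l \<notin> L" and bl: "b l \<noteq> l"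
    if "l \<in> L" for l
    using f that by (auto simp: s_def b_def)
  have sL: "s l \<notin> L" if "l \<in> L" for l
    using nsl[OF that] bl[OF that] by (auto simp: L_def)
  have sb: "s l \<noteq> b l" if "l \<in> L" for l
    using nsl[OF that] nbhd_irrefl[of "s l"] by auto
  have s_inj: "l = k" if "l \<in> L" "k \<in> L" "s l = s k" for l k
    using nsl[OF that(1)] nsl[OF that(2)] bL that by (auto simp: doubleton_eq_iff)
  have "pendant_tree T L s b"
  proof
    show "inj_on b L"
    proof
      fix l k assume lk: "l \<in> L" "k \<in> L" "b l = b k"
      show "l = k"
      proof (rule ccontr)
        assume "l \<noteq> k"
        then have "s l \<noteq> s k" using s_inj lk by blast
        then have "distinct [b l, s l, l, s k, k]"
          using \<open>l \<noteq> k\<close> lk sL[OF lk(1)] sL[OF lk(2)] bL[OF lk(1)] sb[OF lk(1)] sb[OF lk(2)]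
          by auto
        then show False
          using two_paths[OF nl[OF lk(1)] nsl[OF lk(1)] nl[OF lk(2)]] nsl[OF lk(2)] lk(3) by simp
      qed
    qed
    show "b ` L \<inter> s ` L = {}"
    proof -
      have "b l \<noteq> s k" if lk: "l \<in> L" "k \<in> L" for l k
      proof
        assume eq: "b l = s k"
        then have ne: "l \<noteq> k" using sb[OF lk(1)] by auto
        have "s l \<in> N (s k)" using nsl[OF lk(1)] nbhd_sym[of "b l" "s l"] eq by simp
        moreover have "s l \<noteq> k" using sL lk by auto
        ultimately have "s l = b k" using nsl[OF lk(2)] by auto
        moreover have "distinct [l, s l, s k, k]"
          using ne lk sL[OF lk(1)] sL[OF lk(2)] s_inj[OF lk] by auto
        ultimately show False
          using adjacent[OF nl[OF lk(1)] _ nl[OF lk(2)]] nsl[OF lk(1)] nsl[OF lk(2)] eq by simp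
      qed
      then show ?thesis by blast
    qed
    show "L = {l. \<exists>y. N l = {y}}" by (rule L_def)
    show "N l = {s l}" "N (s l) = {b l, l}" if "l \<in> L" for l using nl[OF that] nsl[OF that] .
    show "b ` L \<inter> L = {}" using bL by blast
  qed
  moreover have "L \<noteq> {}"
  proof -
    have "V \<noteq> {}" using large by auto
    then obtain t where t: "t \<in> V" by blast
    have "card V \<ge> 2" using large by simp
    then obtain x w where "x \<noteq> t" "N x = {w}" by (rule leaf_avoiding[OF t])
    then show ?thesis by (auto simp: L_def)
  qed
  ultimately show ?thesis by (rule that)
qed

end

section \<open>The family of trees with pendant paths at all base vertices\<close>

context pendant_tree
begin

lemma V_paths: "F = {} \<Longrightarrow> V = L \<union> s ` L \<union> b ` L"
  using sub by (auto simp: F_def)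

lemma path_unique:
  assumes "l \<in> L" "k \<in> L" "v \<in> {b l, s l, l}" "v \<in> {b k, s k, k}"
  shows "l = k"
  using assms inj_onD[OF inj_base, of l k] inj_onD[OF inj_support, of l k]
    base_not_support base_not_leaf support_not_leaf by blast

lemma base_nbhd:
  assumes "F = {}" "l \<in> L" "q \<in> N (b l)"
  shows "q = s l \<or> q \<in> b ` L"
proof -
  have q: "b l \<in> N q" using assms(3) nbhd_sym by auto
  have "q \<in> L \<union> s ` L \<union> b ` L" using V_paths[OF assms(1)] nbhd_in_V[OF assms(3)] by auto
  moreover have "q \<notin> L"
    using q nbhd_leaf[of q] base_not_support assms(2) by auto
  moreover have "l = k" if "k \<in> L" "q = s k" for k
    using q nbhd_support[OF that(1)] that path_unique[OF assms(2) that(1), of "b l"] by auto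
  ultimately show ?thesis by blast
qed

definition base_tree :: "'a pair_pre_digraph" where
  "base_tree = \<lparr>pverts = b ` L, parcs = {(x, y). x \<in> b ` L \<and> y \<in> b ` L \<and> y \<in> N x}\<rparr>"

text \<open>
  Contracting every pendant path to its base turns a walk in the tree into a walk among the
  bases, so the bases induce a connected subgraph.
\<close>

lemma undirected_tree_base_tree:
  assumes F: "F = {}" and "L \<noteq> {}"
  shows "undirected_tree base_tree"
proof -
  have pg: "pair_graph base_tree"
  proof
    show "symmetric (with_proj base_tree)"
      using nbhd_sym by (auto simp: symmetric_def sym_def base_tree_def)
    show "finite (parcs base_tree)"
      by (rule finite_subset[of _ "b ` L \<times> b ` L"]) (auto simp: base_tree_def finite_L)
  qed (auto simp: base_tree_def finite_L nbhd_irrefl)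
  interpret B: pair_graph base_tree by (rule pg)
  have arc_step: "y = z \<or> (y, z) \<in> parcs base_tree"
    if "p \<in> {b l, s l, l}" "q \<in> {b k, s k, k}" "l \<in> L" "k \<in> L" "q \<in> N p" "y = b l" "z = b k"
    for p q l k y z
  proof (cases "l = k")
    case False
    have pq: "p \<in> N q" using that(5) nbhd_sym by auto
    have "p = b l"
      using that(1,2,5) nbhd_leaf[OF that(3)] nbhd_support[OF that(3)]
        path_unique[OF that(3,4)] False by blast
    moreover have "q = b k"
      using that(1,2) pq nbhd_leaf[OF that(4)] nbhd_support[OF that(4)]
        path_unique[OF that(3,4)] False by blast
    ultimately show ?thesis using that by (auto simp: base_tree_def)
  qed (use that in simp)
  have "(b l, b k) \<in> (parcs base_tree)\<^sup>*" if lk: "l \<in> L" "k \<in> L" for l k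
  proof -
    have "(b l, b k) \<in> (parcs T)\<^sup>*" using sub lk by (intro reachable_in_tree) auto
    have "\<forall>j\<in>L. v \<in> {b j, s j, j} \<longrightarrow> (b l, b j) \<in> (parcs base_tree)\<^sup>*"
      if "(b l, v) \<in> (parcs T)\<^sup>*" for v
      using that
    proof (induction rule: rtrancl_induct)
      case base
      show ?case
      proof (intro ballI impI)
        fix j assume j: "j \<in> L" "b l \<in> {b j, s j, j}"
        have "l = j" by (rule path_unique[OF lk(1) j(1) _ j(2)]) simp
        then show "(b l, b j) \<in> (parcs base_tree)\<^sup>*" by simp
      qed
    next
      case (step v w)
      show ?case
      proof (intro ballI impI)
        fix j assume j: "j \<in> L" "w \<in> {b j, s j, j}"
        have vw: "w \<in> N v" using step.hyps by (simp add: nbhd_def)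
        then have "v \<in> L \<union> s ` L \<union> b ` L" using nbhd_in_V V_paths[OF F] by auto
        then obtain i where i: "i \<in> L" "v \<in> {b i, s i, i}" by auto
        then have "(b l, b i) \<in> (parcs base_tree)\<^sup>*" using step.IH by blast
        moreover have "b i = b j \<or> (b i, b j) \<in> parcs base_tree"
          using arc_step[OF i(2) j(2) i(1) j(1) vw refl refl] .
        ultimately show "(b l, b j) \<in> (parcs base_tree)\<^sup>*" by (auto intro: rtrancl_into_rtrancl)
      qed
    qed
    from this[OF \<open>(b l, b k) \<in> (parcs T)\<^sup>*\<close>] show ?thesis using lk(2) by simp
  qed
  then have "x \<rightarrow>\<^sup>*\<^bsub>with_proj base_tree\<^esub> y" if "x \<in> b ` L" "y \<in> b ` L" for x y
    using that B.reachable_conv'[of x y] by (auto simp: base_tree_def)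
  then have "connected base_tree"
    using B.reachable_mk_symmetricI assms(2)
    unfolding connected_def strongly_connected_def by (auto simp: mk_symmetric_def base_tree_def)
  moreover have "pre_digraph.cycle T p" if "pre_digraph.cycle base_tree p" for p
  proof -
    have "pverts base_tree \<subseteq> V" "parcs base_tree \<subseteq> parcs T"
      using sub by (auto simp: base_tree_def nbhd_def)
    then show ?thesis
      using that
      unfolding pre_digraph.cycle_def pre_digraph.awalk_def cas_with_proj_eq awalk_verts_with_proj_eq
        with_proj_simps
      by blast
  qed
  ultimately show ?thesis
    using pg tree unfolding undirected_tree_def by blast
qed

lemma in_family_if_no_rest:
  assumes F: "F = {}" and "L \<noteq> {}"
  shows "in_family_T T"
proof -
  define g where "g = inv_into L b"
  have gb: "g (b l) = l" if "l \<in> L" for l using that inj_base by (simp add: g_def)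
  define f where "f x = (case x of Base v \<Rightarrow> v | Support v \<Rightarrow> s (g v) | Leaf v \<Rightarrow> g v)" for x
  have f: "f (Base v) = v" "f (Support v) = s (g v)" "f (Leaf v) = g v" for v
    by (simp_all add: f_def)
  let ?A = "attach_paths base_tree"
  define hom where "hom = \<lparr>iso_verts = f, iso_arcs = map_prod f f, iso_head = snd, iso_tail = fst\<rparr>"
  have verts: "pverts ?A = Base ` b ` L \<union> Support ` b ` L \<union> Leaf ` b ` L"
    by (simp add: attach_paths_def base_tree_def)
  have arcs_sub: "parcs ?A \<subseteq> pverts ?A \<times> pverts ?A"
    by (auto simp: attach_paths_def base_tree_def)
  have inj: "inj_on f (pverts ?A)"
  proof
    fix x y assume xy: "x \<in> pverts ?A" "y \<in> pverts ?A" "f x = f y"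
    obtain l where l: "l \<in> L" "x \<in> {Base (b l), Support (b l), Leaf (b l)}" using xy(1) verts by auto
    obtain k where k: "k \<in> L" "y \<in> {Base (b k), Support (b k), Leaf (b k)}" using xy(2) verts by auto
    have "f x \<in> {b l, s l, l}" "f y \<in> {b k, s k, k}" using l k by (auto simp: f gb)
    then have "l = k" using path_unique[OF l(1) k(1)] xy(3) by simp
    moreover have "b l \<noteq> s l" "b l \<noteq> l" "s l \<noteq> l"
      using l(1) base_not_support base_not_leaf support_not_leaf by auto
    ultimately show "x = y" using l k xy(3) by (auto simp: f gb)
  qed
  have "inj_on (map_prod f f) (parcs ?A)"
    using map_prod_inj_on[OF inj inj] arcs_sub by (rule inj_on_subset)
  moreover have "wf_digraph ?A"
    using arcs_sub by unfold_locales auto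
  ultimately have iso: "pre_digraph.digraph_isomorphism ?A hom"
    using inj by (auto simp: pre_digraph.digraph_isomorphism_def hom_def)
  have fV: "f ` pverts ?A = V"
    unfolding verts V_paths[OF F] by (force simp: f gb image_Un image_image)
  have arc: "(f x, f y) \<in> parcs T" if "(x, y) \<in> parcs ?A" for x y
    using that nbhd_leaf nbhd_support nbhd_base
    by (auto simp: attach_paths_def base_tree_def arc_iff f gb)
  have "(p, q) \<in> map_prod f f ` parcs ?A" if "(p, q) \<in> parcs T" for p q
  proof -
    have pq: "q \<in> N p" using that by (simp add: arc_iff)
    have img: "(p, q) \<in> map_prod f f ` parcs ?A" if "(x, y) \<in> parcs ?A" "f x = p" "f y = q" for x y
      using that by force
    have A: "(Base (b l), Support (b l)) \<in> parcs ?A" "(Support (b l), Base (b l)) \<in> parcs ?A"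
      "(Support (b l), Leaf (b l)) \<in> parcs ?A" "(Leaf (b l), Support (b l)) \<in> parcs ?A"
      if "l \<in> L" for l
      using that by (auto simp: attach_paths_def base_tree_def)
    obtain l where l: "l \<in> L" and "p = l \<or> p = s l \<or> p = b l"
      using nbhd_in_V[OF pq] V_paths[OF F] by auto
    then consider "p = l" | "p = s l" | "p = b l" by blast
    then show ?thesis
    proof cases
      case 1
      then have "q = s l" using pq nbhd_leaf[OF l] by simp
      then show ?thesis using img[OF A(4)[OF l]] 1 l by (simp add: f gb)
    next
      case 2
      then have "q = b l \<or> q = l" using pq nbhd_support[OF l] by simp
      then show ?thesis using img[OF A(2)[OF l]] img[OF A(3)[OF l]] 2 l by (auto simp: f gb)
    next
      case 3
      then consider "q = s l" | "q \<in> b ` L" using base_nbhd[OF F l] pq by blast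
      then show ?thesis
      proof cases
        case 1
        then show ?thesis using img[OF A(1)[OF l]] 3 l by (simp add: f gb)
      next
        case 2
        then have "(Base p, Base q) \<in> parcs ?A"
          using pq 3 l by (auto simp: attach_paths_def base_tree_def)
        then show ?thesis by (rule img) (simp_all add: f)
      qed
    qed
  qed
  then have "map_prod f f ` parcs ?A = parcs T" using arc by auto
  then have "app_iso hom ?A = with_proj T"
    using fV by (intro pre_digraph.equality) (auto simp: hom_def)
  then have "digraph_iso ?A T" using iso by (auto simp: digraph_iso_def)
  then show ?thesis
    using undirected_tree_base_tree[OF assms] by (auto simp: in_family_T_def)
qed

text \<open>
  Only the three vertices on the pendant path of a leaf l reach the edge at l, and the pendant paths
  are disjoint.
\<close>

lemma card_covers_ge:
  assumes D: "D \<subseteq> V" "covers D (parcs T)"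
  shows "card L \<le> card D"
proof -
  have "\<exists>v\<in>D. v \<in> {b l, s l, l}" if "l \<in> L" for l
  proof -
    have "(s l, l) \<in> parcs T" using nbhd_support[OF that] by (simp add: arc_iff)
    then obtain v where "v \<in> D" "dom v (s l, l)" using D(2) by (auto simp: covers_def)
    then show ?thesis using dom_support_leaf[OF that] by blast
  qed
  then obtain h where h: "\<forall>l\<in>L. h l \<in> D \<and> h l \<in> {b l, s l, l}" by metis
  have "inj_on h L" using path_unique h by (intro inj_onI) metis
  moreover have "h ` L \<subseteq> D" using h by auto
  ultimately show ?thesis using card_inj_on_le finite_subset[OF D(1) finite_V] by blast
qed

text \<open>
  The edges within reach of a leaf, its support and its base form an increasing chain. Hence a
  minimal ve-dominating set contains at most one of the three.
\<close>

lemma card_minimal: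
  assumes F: "F = {}" and D: "minimal_ve_dominating T D"
  shows "card D = card L"
proof -
  have DV: "D \<subseteq> V" and cov: "covers D (parcs T)"
    using D by (auto simp: minimal_ve_dominating_def ve_dominating_iff)
  have "\<exists>l\<in>L. v \<in> {b l, s l, l}" if "v \<in> D" for v
    using that DV V_paths[OF F] by blast
  then obtain h where h: "\<forall>v\<in>D. h v \<in> L \<and> v \<in> {b (h v), s (h v), h v}" by metis
  have "inj_on h D"
  proof (rule inj_onI, rule ccontr)
    fix u v assume uv: "u \<in> D" "v \<in> D" "h u = h v" "u \<noteq> v"
    define l where "l = h u"
    have l: "l \<in> L" "u \<in> {b l, s l, l}" "v \<in> {b l, s l, l}" using h uv by (auto simp: l_def)
    have redundant: False
      if "x \<in> D" "y \<in> D" "x \<noteq> y" "\<And>p q. \<lbrakk>q \<in> N p; dom x (p, q)\<rbrakk> \<Longrightarrow> dom y (p, q)" for x y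
    proof -
      have "covers (D - {x}) (parcs T)"
        unfolding covers_def
      proof
        fix e assume e: "e \<in> parcs T"
        then obtain w where "w \<in> D" "dom w e" using cov by (auto simp: covers_def)
        then show "\<exists>w\<in>D - {x}. dom w e"
          using that e by (cases e) (auto simp: arc_iff)
      qed
      then have "ve_dominating T (D - {x})" using DV by (auto simp: ve_dominating_iff)
      then show False using D \<open>x \<in> D\<close> unfolding minimal_ve_dominating_def by blast
    qed
    have chain: "dom (s l) (p, q)" if "q \<in> N p" "dom l (p, q)" for p q
      using that nbhd_sym[of q p] nbhd_leaf[OF l(1)] nbhd_support[OF l(1)] by (auto simp: dom_iff)
    have chain': "dom (b l) (p, q)" if "q \<in> N p" "dom (s l) (p, q)" for p q
      using that nbhd_sym[of q p] nbhd_leaf[OF l(1)] nbhd_support[OF l(1)] nbhd_base[OF l(1)]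
      by (auto simp: dom_iff)
    show False
      using redundant[OF uv(1,2)] redundant[OF uv(2,1)] uv(4) l(2,3) chain chain' by blast
  qed
  moreover have "h ` D \<subseteq> L" using h by auto
  ultimately have "card D \<le> card L" using card_inj_on_le finite_L by blast
  then show ?thesis using card_covers_ge[OF DV cov] by simp
qed

lemma well_if_no_rest: "F = {} \<Longrightarrow> well_ve_dominated T"
  by (simp add: well_ve_dominated_def card_minimal)

lemma isolation_number_if_no_rest:
  assumes F: "F = {}"
  shows "3 * isolation_number T = card V"
proof -
  have "covers (b ` L) (parcs T)"
    unfolding covers_def
  proof
    fix e assume "e \<in> parcs T"
    then obtain p q where e: "e = (p, q)" "q \<in> N p" by (cases e) (auto simp: arc_iff)
    have "p \<in> L \<union> s ` L \<union> b ` L" using nbhd_in_V[OF e(2)] V_paths[OF F] by auto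
    moreover have "dom p (p, q)" by (simp add: dom_iff)
    ultimately show "\<exists>v\<in>b ` L. dom v e" using path_dom_base[OF _ e(2)] e(1) by blast
  qed
  then have iso: "isolating T (b ` L)" using sub by (simp add: isolating_iff)
  have "isolation_number T = card L"
    unfolding isolation_number_def
  proof (rule Min_eqI)
    have "{D. isolating T D} \<subseteq> Pow V" by (auto simp: isolating_iff)
    then show "finite (card ` {D. isolating T D})"
      using finite_V by (meson finite_Pow_iff finite_imageI finite_subset)
    show "card L \<in> card ` {D. isolating T D}" using iso by (intro image_eqI[of _ _ "b ` L"]) (simp_all add: card_base)
  qed (auto simp: isolating_iff intro: card_covers_ge)
  then show ?thesis using card_paths V_paths[OF F] by simp
qed

end

context ve_tree
begin

text \<open>
  The attached leaves are the only leaves of the tree: a base of degree one would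
  be a false twin of the leaf behind its support.
\<close>

lemma pendant_tree_if_in_family:
  assumes red: "reduced T" and fam: "in_family_T T"
  obtains L s b where "pendant_tree T L s b" "pendant_tree.F T L s b = {}"
proof -
  obtain T0 :: "'a pair_pre_digraph" and hom where
    iso: "pre_digraph.digraph_isomorphism (attach_paths T0) hom"
    and T: "with_proj T = app_iso hom (attach_paths T0)"
    using fam by (auto simp: in_family_T_def digraph_iso_def)
  let ?A = "attach_paths T0"
  define f where "f = iso_verts hom"
  define I where "I = pverts T0"
  have wf: "wf_digraph ?A" and inj: "inj_on f (pverts ?A)"
    using iso by (auto simp: pre_digraph.digraph_isomorphism_def f_def)
  have A: "x \<in> pverts ?A \<and> y \<in> pverts ?A" if "(x, y) \<in> parcs ?A" for x y
    using wf_digraph.wellformed[OF wf, of "(x, y)"] that by auto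
  have vertsA: "pverts ?A = Base ` I \<union> Support ` I \<union> Leaf ` I"
    by (simp add: attach_paths_def I_def)
  have V: "V = f ` pverts ?A" using arg_cong[OF T, of verts] by (simp add: f_def)
  have ends: "fst (iso_arcs hom (x, y)) = f x \<and> snd (iso_arcs hom (x, y)) = f y"
    if "(x, y) \<in> parcs ?A" for x y
  proof -
    have "fst = iso_tail hom" "snd = iso_head hom"
      using arg_cong[OF T, of tail] arg_cong[OF T, of head] by simp_all
    then show ?thesis
      using iso that by (auto simp: pre_digraph.digraph_isomorphism_def f_def)
  qed
  have P: "parcs T = {(f x, f y) | x y. (x, y) \<in> parcs ?A}"
  proof -
    have "parcs T = iso_arcs hom ` parcs ?A" using arg_cong[OF T, of arcs] by simp
    also have "\<dots> = (\<lambda>(x, y). (f x, f y)) ` parcs ?A"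
      using ends by (intro image_cong) (auto simp: prod_eq_iff)
    finally show ?thesis by auto
  qed
  have nb: "N (f x) = f ` {y. (x, y) \<in> parcs ?A}" if x: "x \<in> pverts ?A" for x
  proof -
    have "x' = x" if "f x' = f x" "(x', y) \<in> parcs ?A" for x' y
      using inj_onD[OF inj that(1)] A[OF that(2)] x by blast
    then show ?thesis using P by (fastforce simp: nbhd_def)
  qed
  have nL: "N (f (Leaf i)) = {f (Support i)}"
    and nS: "N (f (Support i)) = {f (Base i), f (Leaf i)}" if "i \<in> I" for i
  proof -
    have "{y. (Leaf i, y) \<in> parcs ?A} = {Support i}"
      "{y. (Support i, y) \<in> parcs ?A} = {Base i, Leaf i}"
      using that by (auto simp: attach_paths_def I_def)
    then show "N (f (Leaf i)) = {f (Support i)}" "N (f (Support i)) = {f (Base i), f (Leaf i)}"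
      using nb[of "Leaf i"] nb[of "Support i"] that vertsA by auto
  qed
  have feq: "f x = f y \<longleftrightarrow> x = y" if "x \<in> pverts ?A" "y \<in> pverts ?A" for x y
    using inj_on_eq_iff[OF inj that] .
  define L where "L = (f \<circ> Leaf) ` I"
  define g where "g = inv_into I (f \<circ> Leaf)"
  define s where "s l = f (Support (g l))" for l
  define b where "b l = f (Base (g l))" for l
  have injL: "inj_on (f \<circ> Leaf) I" using feq vertsA by (intro inj_onI) auto
  have g: "g (f (Leaf i)) = i" if "i \<in> I" for i
    using inv_into_f_f[OF injL that] by (simp add: g_def)
  have base_not_singleton: "N (f (Base i)) \<noteq> {y}" if i: "i \<in> I" for i y
  proof
    assume y: "N (f (Base i)) = {y}"
    have "f (Support i) \<in> N (f (Base i))" using nS[OF i] nbhd_sym by auto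
    then have "N (f (Base i)) = N (f (Leaf i))" using y nL[OF i] by simp
    moreover have "f (Base i) \<in> V" "f (Leaf i) \<in> V" "f (Base i) \<noteq> f (Leaf i)"
      using i vertsA V feq[of "Base i" "Leaf i"] by auto
    ultimately show False using red by (auto simp: reduced_def false_twins_def)
  qed
  have pt: "pendant_tree T L s b"
  proof
    show "L = {l. \<exists>y. N l = {y}}"
    proof
      show "L \<subseteq> {l. \<exists>y. N l = {y}}" using nL by (auto simp: L_def)
      show "{l. \<exists>y. N l = {y}} \<subseteq> L"
      proof
        fix x assume "x \<in> {l. \<exists>y. N l = {y}}"
        then obtain y where y: "N x = {y}" by blast
        then have "x \<in> V" using nbhd_in_V[of y x] by simp
        then obtain i where i: "i \<in> I" "x = f (Base i) \<or> x = f (Support i) \<or> x = f (Leaf i)"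
          using V vertsA by auto
        moreover have "x \<noteq> f (Support i)"
          using y nS[OF i(1)] feq[of "Base i" "Leaf i"] i(1) vertsA by auto
        ultimately show "x \<in> L" using y base_not_singleton by (auto simp: L_def)
      qed
    qed
    show "N l = {s l}" "N (s l) = {b l, l}" if "l \<in> L" for l
      using that nL nS by (auto simp: L_def s_def b_def g)
    show "inj_on b L" using feq vertsA by (intro inj_onI) (auto simp: L_def b_def g)
    show "b ` L \<inter> s ` L = {}" "b ` L \<inter> L = {}"
      using feq vertsA by (auto simp: L_def b_def s_def g)
  qed
  moreover have "L \<union> s ` L \<union> b ` L = V"
    unfolding V vertsA by (force simp: L_def s_def b_def g)
  ultimately show ?thesis using that pendant_tree.F_def[OF pt] by simp
qed

lemma well_imp_in_family:
  assumes "reduced T" "card V \<ge> 3" and well: "well_ve_dominated T"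
  shows "in_family_T T"
proof -
  obtain L s b where pt: "pendant_tree T L s b" "L \<noteq> {}"
    using assms(1,2)
  proof (rule pendant_tree_exists)
    fix l y a b c c'
    assume "N l = {y}" "a \<in> N y" "b \<in> N y" "a \<noteq> b" "c \<in> N a" "c \<noteq> y" "c' \<in> N b" "c' \<noteq> y"
    then show False by (rule well_support_le_one_inner_nbr[OF well])
  qed (use well_two_pendant_paths[OF well] well_adjacent_supports[OF well] in blast)+
  interpret pendant_tree T L s b by (rule pt)
  show ?thesis by (rule in_family_if_no_rest[OF well_no_rest[OF well pt(2)] pt(2)])
qed

lemma third_imp_in_family:
  assumes "reduced T" "card V \<ge> 3" and third: "card V = 3 * isolation_number T"
  shows "in_family_T T"
proof -
  have bound: "third_lower_bound"
    using isolation_number_le third by (simp add: third_lower_bound_def)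
  obtain L s b where pt: "pendant_tree T L s b" "L \<noteq> {}"
    using assms(1,2)
  proof (rule pendant_tree_exists)
    fix l y a b
    assume "N l = {y}" "a \<in> N y" "b \<in> N y" "a \<noteq> b" "a \<noteq> l" "b \<noteq> l"
    then show False by (rule bound_support_le_one_inner_nbr[OF bound assms(2)])
  qed (use bound_two_pendant_paths[OF bound] bound_adjacent_supports[OF bound] in blast)+
  interpret pendant_tree T L s b by (rule pt)
  show ?thesis by (rule in_family_if_no_rest[OF bound_no_rest[OF bound pt(2)] pt(2)])
qed

lemma in_family_imp:
  assumes "reduced T" "in_family_T T"
  shows "well_ve_dominated T" "3 * isolation_number T = card V"
proof -
  obtain L s b where pt: "pendant_tree T L s b" "pendant_tree.F T L s b = {}"
    using pendant_tree_if_in_family[OF assms] .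
  interpret pendant_tree T L s b by (rule pt)
  show "well_ve_dominated T" "3 * isolation_number T = card V"
    using well_if_no_rest isolation_number_if_no_rest pt(2) by auto
qed

end

theorem corollary24:
  fixes T :: "'a pair_pre_digraph"
  assumes "undirected_tree T"
    and "reduced T"
    and "card (pverts T) \<ge> 3"
  shows "(well_ve_dominated T \<longleftrightarrow> in_family_T T) \<and>
         (in_family_T T \<longleftrightarrow> real (isolation_number T) = real (card (pverts T)) / 3)"
proof -
  interpret ve_tree T by standard (rule assms(1))
  have "real (isolation_number T) = real (card V) / 3 \<longleftrightarrow> card V = 3 * isolation_number T"
    by (auto simp: field_simps simp flip: of_nat_mult)
  moreover have "well_ve_dominated T \<longleftrightarrow> in_family_T T"
    using well_imp_in_family in_family_imp(1) assms(2,3) by blast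
  moreover have "card V = 3 * isolation_number T \<longleftrightarrow> in_family_T T"
    using third_imp_in_family in_family_imp(2) assms(2,3) by auto
  ultimately show ?thesis by simp
qed

end
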